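(* Let $i\in\{1,2,\ldots,p\}$ and let $$\mathcal{A}_i = \{ \bar{x} \in \mathcal{G}_i \mid \exists\, u \in \mathcal{U} : x^{(\bar{x},u)}(t) \in \mathcal{G}_i \ \ \forall t \geq 0 \}$$ be the individual admissible set of the linear system $\dot x(t)=Ax(t)+Bu(t)$ for the constraint $H_ix(t)+h_i\le0$. For any $N\in\mathbb{N}$ and any finite set $\mathcal{S}_i=\{x_1,x_2,\ldots,x_N\}\subseteq\partial\mathcal{A}_i$ of $N$ points, $$\mathrm{conv}(\mathcal{S}_i)\subseteq\mathcal{A}_i.$$
   Context: $A\in\mathbb{R}^{n\times n}$, $B\in\mathbb{R}^{n\times m}$; $\mathbb{U}\subset\mathbb{R}^m$ is nonempty, convex and compact; $\mathcal{U}$ is the set of Lebesgue-measurable functions $u:[0,\infty)\to\mathbb{U}$. For $x_0\in\mathbb{R}^n$ and $u\in\mathcal{U}$, $x^{(x_0,u)}$ denotes the absolutely continuous solution of $\dot x(t)=Ax(t)+Bu(t)$, $x(0)=x_0$. $H\in\mathbb{R}^{p\times n}$ has rows $H_1,\dots,H_p$, all nonzero, and $h\in\mathbb{R}^p$ has components $h_1,\dots,h_p$. $\mathcal{G}_i=\{x\in\mathbb{R}^n \mid H_ix+h_i\le0\}$. It is assumed that $\mathcal{G}=\{x\in\mathbb{R}^n\mid H_ix+h_i\le 0 \text{ for all } i\}$ has nonempty interior and that the set $\{x\in\mathbb{R}^n \mid \exists\, i: H_ix+h_i=0\}$ is nonempty. $\partial\mathcal{A}_i$ is the topological boundary of $\mathcal{A}_i$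 in $\mathbb{R}^n$, and $\mathrm{conv}$ denotes the convex hull. *)

theory Defs
  imports "HOL-Analysis.Analysis"
begin

text \<open>
  The usual \<open>\<epsilon>\<close>-\<open>\<delta>\<close> definition: \<open>D division_of \<Union>D\<close> says that \<open>D\<close> is a finite family of nonempty
  compact intervals with pairwise disjoint interiors, and \<open>Inf k\<close>, \<open>Sup k\<close> are the endpoints of \<open>k\<close>.
\<close>
definition absolutely_continuous_on :: "real set \<Rightarrow> (real \<Rightarrow> 'a::real_normed_vector) \<Rightarrow> bool" where
  "absolutely_continuous_on S f \<longleftrightarrow>
     (\<forall>\<epsilon>>0. \<exists>\<delta>>0. \<forall>D. D division_of \<Union>D \<and> \<Union>D \<subseteq> S \<and> (\<Sum>k\<in>D. Sup k - Inf k) < \<delta> \<longrightarrow>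
        (\<Sum>k\<in>D. norm (f (Sup k) - f (Inf k))) < \<epsilon>)"

text \<open>
  Controls and trajectories live on \<open>[0,\<infinity>)\<close>; their values at negative times are unconstrained
  and irrelevant.
\<close>
definition controls :: "(real^'m) set \<Rightarrow> (real \<Rightarrow> real^'m) set" where
  "controls U = {u. u \<in> borel_measurable (lebesgue_on {0..}) \<and> (\<forall>t\<ge>0. u t \<in> U)}"

text \<open>
  A Caratheodory solution of \<open>x'(t) = A x(t) + B u(t)\<close>, \<open>x(0) = x0\<close>: absolutely continuous on
  every compact subinterval of \<open>[0,\<infinity>)\<close>, with the equation holding at almost every time.
\<close>
definition is_solution ::
  "real^'n^'n \<Rightarrow> real^'m^'n \<Rightarrow> real^'n \<Rightarrow> (real \<Rightarrow> real^'m) \<Rightarrow> (real \<Rightarrow> real^'n) \<Rightarrow> bool" where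
  "is_solution A B x0 u x \<longleftrightarrow>
     x 0 = x0 \<and>
     (\<forall>T\<ge>0. absolutely_continuous_on {0..T} x) \<and>
     (AE t in lebesgue_on {0..}.
        (x has_vector_derivative (A *v x t + B *v u t)) (at t within {0..}))"

definition constraint_set :: "real^'n^'p \<Rightarrow> real^'p \<Rightarrow> 'p \<Rightarrow> (real^'n) set" where
  "constraint_set H h i = {x. H $ i \<bullet> x + h $ i \<le> 0}"

text \<open>
  For a control \<open>u\<close> the solution from a given initial state is unique on \<open>[0,\<infinity>)\<close>, so it is
  described by the relation \<open>is_solution\<close> rather than by a choice operator.
\<close>
definition admissible_set ::
  "real^'n^'n \<Rightarrow> real^'m^'n \<Rightarrow> (real^'m) set \<Rightarrow> real^'n^'p \<Rightarrow> real^'p \<Rightarrow> 'p \<Rightarrow> (real^'n) set" where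
  "admissible_set A B U H h i =
     {x0 \<in> constraint_set H h i.
        \<exists>u\<in>controls U. \<exists>x. is_solution A B x0 u x \<and> (\<forall>t\<ge>0. x t \<in> constraint_set H h i)}"

end

theory Submission
  imports Defs "HOL-Complex_Analysis.Great_Picard"
begin

text \<open>
  A set contains the convex hull of any subset of its frontier as soon as it is closed and convex,
  so the theorem rests on these two properties of the admissible set.

  Convexity is linearity: a convex combination of two solutions solves the equation for the same
  convex combination of the controls (\<open>is_solution_convex_combination\<close>), which again takes values in
  the convex set \<open>U\<close>, and the constraint is a half-space.

  Closedness is a compactness property of the solution set (\<open>solutions_sequentially_compact\<close>): if the
  initial states converge, then a subsequence of the solutions converges pointwise to a solution,
  and the constraint survives the limit. The controls themselves need not converge pointwise. Their
  primitives \<open>z n t = integral {0..t} (u n)\<close> do, along a subsequence, because together with the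
  trajectories \<open>x n\<close> they are locally uniformly bounded and Lipschitz (Gronwall's inequality). In the
  integrated equation \<open>x n t = x0 n + A *v integral {0..t} (x n) + B *v z n t\<close> every term passes to the
  limit, and a control is recovered by differentiating the limit primitive \<open>Z\<close>. All difference
  quotients of \<open>Z\<close> are limits of averages of controls, hence lie in the closed convex set \<open>U\<close>, and so
  does the derivative of \<open>Z\<close>, wherever it exists.

  Two facts of real analysis make this work with Lebesgue measurable controls. An absolutely
  continuous function is the integral of its almost everywhere defined derivative
  (\<open>absolutely_continuous_on_has_integral\<close>), which gives the integrated equation. A Lipschitz function
  of one real variable is differentiable almost everywhere (\<open>lipschitz_differentiable_ae\<close>, from Vitali's
  covering theorem), which gives the limit control.
\<close>

section \<open>The fundamental theorem of calculus for absolutely continuous functions\<close>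

text \<open>
  The gauge treats two kinds of tags differently. At a tag outside \<open>N\<close> the derivative controls the
  increment of \<open>f\<close> over the tagged interval, as in the classical theorem. The intervals tagged in
  \<open>N\<close> are forced into an open set \<open>W\<close> of measure below \<open>\<delta>\<close>, and absolute continuity makes their
  total increment small, while the integrand may be taken to vanish on \<open>N\<close>.
\<close>
lemma absolutely_continuous_on_has_integral:
  fixes f :: "real \<Rightarrow> 'a::banach"
  assumes "a \<le> b" and ac: "absolutely_continuous_on {a..b} f" and N: "negligible N"
    and deriv: "\<And>t. t \<in> {a..b} - N \<Longrightarrow> (f has_vector_derivative f' t) (at t within {a..b})"
  shows "(f' has_integral (f b - f a)) {a..b}"
proof -
  define g where "g t = (if t \<in> N then 0 else f' t)" for t
  have "(g has_integral (f b - f a)) {a..b}"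
    unfolding has_integral_real
  proof safe
    fix e :: real
    assume "e > 0"
    define \<eta> where "\<eta> = e / (2 * (b - a + 1))"
    have \<eta>: "\<eta> > 0" "\<eta> * (b - a) < e / 2"
      using \<open>e > 0\<close> \<open>a \<le> b\<close> by (auto simp: \<eta>_def field_simps)
    have "\<forall>x. \<exists>d>0. x \<in> {a..b} - N \<longrightarrow>
         (\<forall>y\<in>{a..b}. norm (y-x) < d \<longrightarrow> norm (f y - f x - (y-x) *\<^sub>R f' x) \<le> \<eta> * norm (y-x))"
      using deriv[unfolded has_vector_derivative_def has_derivative_within_alt] \<eta>(1) zero_less_one
      by blast
    then obtain d where d: "\<And>x. 0 < d x"
                 "\<And>x y. \<lbrakk>x \<in> {a..b} - N; y \<in> {a..b}; norm (y-x) < d x\<rbrakk>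
                        \<Longrightarrow> norm (f y - f x - (y-x) *\<^sub>R f' x) \<le> \<eta> * norm (y-x)"
      by metis
    obtain \<delta> where "\<delta> > 0" and \<delta>: "\<And>D. \<lbrakk>D division_of \<Union>D; \<Union>D \<subseteq> {a..b}; (\<Sum>k\<in>D. Sup k - Inf k) < \<delta>\<rbrakk>
          \<Longrightarrow> (\<Sum>k\<in>D. norm (f (Sup k) - f (Inf k))) < e/2"
      using ac \<open>e > 0\<close> unfolding absolutely_continuous_on_def by (meson half_gt_zero)
    obtain W where W: "open W" "N \<subseteq> W" "W - N \<in> lmeasurable" "emeasure lebesgue (W - N) < ennreal \<delta>"
      using sets_lebesgue_outer_open[OF negligible_imp_sets[OF N] \<open>\<delta> > 0\<close>] by metis
    have Wm: "W \<in> lmeasurable"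
      using W N by (metis fmeasurable.Un negligible_imp_measurable Diff_partition)
    have "measure lebesgue W = measure lebesgue (W - N)"
      by (rule measure_negligible_symdiff)
        (use N W Wm in \<open>auto intro: negligible_subset simp: fmeasurableD\<close>)
    then have mW: "measure lebesgue W < \<delta>"
      using W(3,4) \<open>\<delta> > 0\<close> by (simp add: emeasure_eq_measure2 ennreal_less_iff)
    define \<gamma> where "\<gamma> x = (if x \<in> N then W else ball x (d x))" for x
    have "gauge \<gamma>"
      using W d(1) by (auto simp: gauge_def \<gamma>_def)
    moreover have "norm ((\<Sum>(x, k)\<in>p. measure lborel k *\<^sub>R g x) - (f b - f a)) < e"
      if p: "p tagged_division_of {a..b}" and fine: "\<gamma> fine p" for p
    proof -
      define q where "q = {t \<in> p. fst t \<in> N}"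
      have "finite p" using p by blast
      have K: "\<exists>u v. K = {u..v} \<and> u \<le> v \<and> a \<le> u \<and> v \<le> b \<and> x \<in> {u..v}" if xK: "(x, K) \<in> p" for x K
      proof -
        have "x \<in> K" "K \<subseteq> {a..b}" using p xK by blast+
        moreover obtain u v where "K = cbox u v" using tagged_division_ofD(4)[OF p xK] by metis
        ultimately show ?thesis
          by (intro exI[of _ u] exI[of _ v]) auto
      qed
      have ba: "b - a = (\<Sum>(x,K)\<in>p. Sup K - Inf K)" "f b - f a = (\<Sum>(x,K)\<in>p. f(Sup K) - f(Inf K))"
        using additive_tagged_division_1[where f= "\<lambda>x. x"] additive_tagged_division_1[where f= f]
            \<open>a \<le> b\<close> p by auto
      have good: "norm (measure lborel K *\<^sub>R g x - (f (Sup K) - f (Inf K))) \<le> \<eta> * (Sup K - Inf K)"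
        if gK: "(x, K) \<in> p - q" for x K
      proof -
        obtain u v where k: "K = {u..v}" "u \<le> v" "a \<le> u" "v \<le> b" "u \<le> x" "x \<le> v"
          using K[of x K] gK by (auto simp: q_def)
        have "x \<notin> N" using gK by (auto simp: q_def)
        then have "{u..v} \<subseteq> ball x (d x)"
          using fine gK k by (force simp: fine_def \<gamma>_def)
        then have uv: "norm (u - x) < d x" "norm (v - x) < d x"
          using k by (auto simp: subset_iff dist_real_def dest: spec[of _ u] spec[of _ v])
        have "norm ((v - u) *\<^sub>R f' x - (f v - f u))
            = norm ((f u - f x - (u - x) *\<^sub>R f' x) - (f v - f x - (v - x) *\<^sub>R f' x))"
          by (auto simp: algebra_simps)
        also have "\<dots> \<le> norm (f u - f x - (u - x) *\<^sub>R f' x) + norm (f v - f x - (v - x) *\<^sub>R f' x)"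
          by (rule norm_triangle_ineq4)
        also have "\<dots> \<le> \<eta> * norm (u - x) + \<eta> * norm (v - x)"
          by (intro add_mono d uv) (use k \<open>x \<notin> N\<close> in auto)
        also have "\<dots> = \<eta> * (v - u)"
          using k by (auto simp: algebra_simps)
        finally show ?thesis
          using k \<open>x \<notin> N\<close> by (simp add: g_def)
      qed
      have bad: "(\<Sum>(x,K)\<in>q. norm (measure lborel K *\<^sub>R g x - (f (Sup K) - f (Inf K)))) < e/2"
      proof -
        have "q tagged_partial_division_of {a..b}"
          using p by (auto simp: tagged_division_of_def q_def intro: tagged_partial_division_subset)
        then have q: "q tagged_division_of (\<Union>(snd ` q))"
          by (rule tagged_partial_division_of_Union_self)
        define D where "D = snd ` q"
        have D: "D division_of \<Union>D"
          using division_of_tagged_division[OF q] by (simp add: D_def)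
        have DK: "\<exists>u v. K = {u..v} \<and> u \<le> v \<and> a \<le> u \<and> v \<le> b \<and> {u..v} \<subseteq> W" if KD: "K \<in> D" for K
        proof -
          obtain x where "(x, K) \<in> p" "x \<in> N" using KD by (auto simp: D_def q_def)
          moreover from this have "K \<subseteq> W"
            using fine by (force simp: fine_def \<gamma>_def)
          ultimately show ?thesis using K[of x K] by auto
        qed
        have "(\<Sum>K\<in>D. Sup K - Inf K) = (\<Sum>K\<in>D. measure lebesgue K)"
          by (intro sum.cong refl) (use DK in fastforce)
        also have "\<dots> = measure lebesgue (\<Union>D)"
          using content_division[OF D] .
        also have "\<dots> \<le> measure lebesgue W"
        proof (rule measure_mono_fmeasurable[OF _ _ Wm])
          show "\<Union>D \<subseteq> W" using DK by fastforce
          show "\<Union>D \<in> sets lebesgue" using lmeasurable_division[OF D] by blast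
        qed
        finally have len: "(\<Sum>K\<in>D. Sup K - Inf K) < \<delta>" using mW by simp
        \<comment> \<open>\<open>Sup {}\<close> and \<open>Inf {}\<close> are unspecified reals, so the empty set needs a separate value.\<close>
        define \<phi> where "\<phi> K = (if K = {} then 0 else norm (f (Sup K) - f (Inf K)))" for K
        have "(\<Sum>(x,K)\<in>q. norm (measure lborel K *\<^sub>R g x - (f (Sup K) - f (Inf K)))) = (\<Sum>(x,K)\<in>q. \<phi> K)"
        proof (intro sum.cong refl, clarify)
          fix x K assume "(x, K) \<in> q"
          moreover from this have "K \<noteq> {}" using K[of x K] by (auto simp: q_def)
          ultimately show "norm (measure lborel K *\<^sub>R g x - (f (Sup K) - f (Inf K))) = \<phi> K"
            by (simp add: \<phi>_def g_def q_def norm_minus_commute)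
        qed
        also have "\<dots> = (\<Sum>K\<in>D. \<phi> K)"
          unfolding D_def
        proof (rule sum.over_tagged_division_lemma[OF q])
          fix u v :: real assume "box u v = {}"
          then show "\<phi> (cbox u v) = 0" by (cases "u = v") (auto simp: \<phi>_def)
        qed
        also have "\<dots> = (\<Sum>K\<in>D. norm (f (Sup K) - f (Inf K)))"
        proof (intro sum.cong refl)
          fix K assume "K \<in> D" then show "\<phi> K = norm (f (Sup K) - f (Inf K))"
            using DK[of K] by (auto simp: \<phi>_def)
        qed
        also have "\<dots> < e/2"
        proof (rule \<delta>[OF D _ len])
          show "\<Union>D \<subseteq> {a..b}"
            using DK by fastforce
        qed
        finally show ?thesis .
      qed
      have "(\<Sum>(x, k)\<in>p. measure lborel k *\<^sub>R g x) - (f b - f a)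
          = (\<Sum>(x,K)\<in>p. measure lborel K *\<^sub>R g x - (f (Sup K) - f (Inf K)))"
        by (simp add: ba split_def sum_subtractf)
      also have "norm \<dots> \<le> (\<Sum>(x,K)\<in>p. norm (measure lborel K *\<^sub>R g x - (f (Sup K) - f (Inf K))))"
        by (rule sum_norm_le) auto
      also have "\<dots> = (\<Sum>(x,K)\<in>p - q. norm (measure lborel K *\<^sub>R g x - (f (Sup K) - f (Inf K))))
                 + (\<Sum>(x,K)\<in>q. norm (measure lborel K *\<^sub>R g x - (f (Sup K) - f (Inf K))))"
        by (rule sum.subset_diff) (use \<open>finite p\<close> in \<open>auto simp: q_def\<close>)
      also have "(\<Sum>(x,K)\<in>p - q. norm (measure lborel K *\<^sub>R g x - (f (Sup K) - f (Inf K))))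
            \<le> (\<Sum>(x,K)\<in>p - q. \<eta> * (Sup K - Inf K))"
        by (rule sum_mono) (use good in auto)
      also have "\<dots> \<le> (\<Sum>(x,K)\<in>p. \<eta> * (Sup K - Inf K))"
      proof (rule sum_mono2[OF \<open>finite p\<close>])
        show "0 \<le> (case t of (x, K) \<Rightarrow> \<eta> * (Sup K - Inf K))" if "t \<in> p - (p - q)" for t
          using that K[of "fst t" "snd t"] \<eta>(1) by (cases t) auto
      qed auto
      also have "\<dots> = \<eta> * (b - a)"
        by (simp add: ba(1) sum_distrib_left split_def)
      finally show ?thesis using bad \<eta>(2) by linarith
    qed
    ultimately show "\<exists>\<gamma>. gauge \<gamma> \<and> (\<forall>p. p tagged_division_of {a..b} \<and> \<gamma> fine p \<longrightarrow>
        norm ((\<Sum>(x, k)\<in>p. measure lborel k *\<^sub>R g x) - (f b - f a)) < e)"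
      by metis
  qed
  then show ?thesis
    by (rule has_integral_spike[OF N, rotated]) (auto simp: g_def)
qed

section \<open>Almost everywhere differentiability of Lipschitz functions\<close>

text \<open>
  A comparison on intervals passes to Borel sets: Vitali's theorem selects countably many disjoint
  intervals inside the open set \<open>W\<close>, which cover \<open>E\<close> up to a null set of \<open>\<mu>\<close>, and the comparison is
  summed over them. For \<open>\<nu>\<close> outer regularity replaces \<open>W\<close> by \<open>E\<close>.
\<close>
lemma emeasure_le_if_Vitali_cover_le:
  fixes \<mu> \<nu> :: "real measure"
  assumes sets: "sets \<mu> = sets borel" "sets \<nu> = sets borel" and E: "E \<in> sets borel"
    and null: "\<And>N. N \<in> null_sets lborel \<Longrightarrow> emeasure \<mu> N = 0"
    and outer: "\<And>e::real. (0::real) < e \<Longrightarrow> \<exists>W. open W \<and> E \<subseteq> W \<and> emeasure \<nu> W \<le> emeasure \<nu> E + e"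
    and cover: "\<And>x d. x \<in> E \<Longrightarrow> d > 0 \<Longrightarrow>
      \<exists>u v. u < x \<and> x < v \<and> v - u < d \<and> emeasure \<mu> {u..v} \<le> emeasure \<nu> {u..v}"
  shows "emeasure \<mu> E \<le> emeasure \<nu> E"
proof (rule ennreal_le_epsilon)
  fix e :: real assume "e > 0"
  then obtain W where W: "open W" "E \<subseteq> W" "emeasure \<nu> W \<le> emeasure \<nu> E + e"
    using outer[OF \<open>e > 0\<close>] by blast
  \<comment> \<open>Vitali's theorem speaks of closed balls; an interval is the ball around its midpoint.\<close>
  define K where "K = {(u, v). u < v \<and> {u..v} \<subseteq> W \<and> emeasure \<mu> {u..v} \<le> emeasure \<nu> {u..v}}"
  let ?a = "\<lambda>(u, v). (u + v) / 2" and ?r = "\<lambda>(u, v). (v - u) / (2::real)"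
  have cball: "cball (?a k) (?r k) = {fst k..snd k}" for k
  proof -
    have "(u + v) / 2 - (v - u) / 2 = u" "(u + v) / 2 + (v - u) / 2 = v" for u v :: real
      by (simp_all add: field_simps)
    then show ?thesis by (simp add: cball_eq_atLeastAtMost split_def)
  qed
  obtain C where C: "countable C" "C \<subseteq> K"
    "pairwise (\<lambda>i j. disjnt (cball (?a i) (?r i)) (cball (?a j) (?r j))) C"
    "negligible (E - (\<Union>i\<in>C. cball (?a i) (?r i)))"
  proof (rule Vitali_covering_theorem_cballs[of K ?r E ?a])
    show "0 < ?r i" if "i \<in> K" for i using that by (auto simp: K_def)
    fix x d :: real assume x: "x \<in> E" "0 < d"
    then obtain \<delta> where \<delta>: "\<delta> > 0" "ball x \<delta> \<subseteq> W"
      using W(1,2) openE by blast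
    obtain u v where uv: "u < x" "x < v" "v - u < min \<delta> d" "emeasure \<mu> {u..v} \<le> emeasure \<nu> {u..v}"
      using cover[OF x(1), of "min \<delta> d"] x(2) \<delta>(1) by auto
    have "{u..v} \<subseteq> ball x \<delta>"
      using uv by (simp add: subset_eq dist_real_def abs_less_iff)
    then have "{u..v} \<subseteq> W" using \<delta>(2) by (rule subset_trans)
    then have "(u, v) \<in> K" using uv by (simp add: K_def)
    moreover have "x \<in> cball (?a (u, v)) (?r (u, v))"
      unfolding cball using uv by simp
    moreover have "?r (u, v) < d" using uv by simp
    ultimately show "\<exists>i. i \<in> K \<and> x \<in> cball (?a i) (?r i) \<and> ?r i < d"
      by (intro exI[of _ "(u, v)"] conjI)
  qed
  define J where "J k = {fst k..snd k}" for k :: "real \<times> real"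
  have eq: "(\<Union>i\<in>C. cball (?a i) (?r i)) = (\<Union>k\<in>C. J k)"
    by (simp only: cball J_def)
  have disj: "disjoint_family_on J C"
    unfolding disjoint_family_on_def
  proof (intro ballI impI)
    fix i j assume ij: "i \<in> C" "j \<in> C" "i \<noteq> j"
    then have "disjnt (cball (?a i) (?r i)) (cball (?a j) (?r j))"
      using C(3) by (simp add: pairwise_def)
    then show "J i \<inter> J j = {}"
      by (simp only: cball J_def disjnt_def)
  qed
  have Jm: "J k \<in> sets borel" for k by (simp add: J_def)
  have Um: "(\<Union>k\<in>C. J k) \<in> sets borel"
    using C(1) Jm by (intro sets.countable_UN') auto
  have "E - (\<Union>k\<in>C. J k) \<in> null_sets lborel"
    using C(4) E Um unfolding eq negligible_iff_null_sets
    by (simp add: null_sets_completion_iff)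
  then have rest: "emeasure \<mu> (E - (\<Union>k\<in>C. J k)) = 0" by (rule null)
  have "emeasure \<mu> E \<le> emeasure \<mu> ((\<Union>k\<in>C. J k) \<union> (E - (\<Union>k\<in>C. J k)))"
    by (intro emeasure_mono) (use E Um sets in auto)
  also have "\<dots> \<le> emeasure \<mu> (\<Union>k\<in>C. J k) + emeasure \<mu> (E - (\<Union>k\<in>C. J k))"
    by (intro emeasure_subadditive) (use E Um sets in auto)
  also have "\<dots> = emeasure \<mu> (\<Union>k\<in>C. J k)" by (simp add: rest)
  also have "\<dots> = (\<integral>\<^sup>+k. emeasure \<mu> (J k) \<partial>count_space C)"
    by (intro emeasure_UN_countable) (use C(1) disj Jm sets in auto)
  also have "\<dots> \<le> (\<integral>\<^sup>+k. emeasure \<nu> (J k) \<partial>count_space C)"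
    by (intro nn_integral_mono) (use C(2) in \<open>auto simp: J_def K_def\<close>)
  also have "\<dots> = emeasure \<nu> (\<Union>k\<in>C. J k)"
    by (intro emeasure_UN_countable[symmetric]) (use C(1) disj Jm sets in auto)
  also have "\<dots> \<le> emeasure \<nu> W"
  proof (rule emeasure_mono)
    have "J k \<subseteq> W" if "k \<in> C" for k
      using subsetD[OF C(2) that] by (auto simp: J_def K_def)
    then show "(\<Union>k\<in>C. J k) \<subseteq> W" by blast
  qed (use W(1) sets in auto)
  finally show "emeasure \<mu> E \<le> emeasure \<nu> E + e"
    using W(3) by (rule order_trans)
qed

text \<open>
  A strict increase over an interval persists, by continuity, when both endpoints move outwards a
  little.
\<close>
lemma widen_increment:
  fixes \<phi> :: "real \<Rightarrow> real"
  assumes cont: "continuous_on UNIV \<phi>" and "u \<le> t" "t \<le> v" "v - u < d" "\<phi> u < \<phi> v"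
  obtains u' v' where "u' < t" "t < v'" "v' - u' < d" "\<phi> u' < \<phi> v'"
proof -
  have "((\<lambda>\<eta>. \<phi> (v + \<eta>) - \<phi> (u - \<eta>)) \<longlongrightarrow> \<phi> (v + 0) - \<phi> (u - 0)) (at_right 0)"
    by (intro tendsto_intros continuous_on_tendsto_compose[OF cont]) auto
  then have "\<forall>\<^sub>F \<eta> in at_right 0. 0 < \<phi> (v + \<eta>) - \<phi> (u - \<eta>)"
    by (rule order_tendstoD) (use assms in simp)
  moreover have "\<forall>\<^sub>F \<eta> in at_right (0::real). \<eta> < (d - (v - u)) / 2"
    using assms by (intro order_tendstoD(2)[OF tendsto_ident_at]) auto
  moreover have "\<forall>\<^sub>F \<eta> in at_right (0::real). \<eta> > 0"
    by (simp add: eventually_at_right_less)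
  ultimately have "\<forall>\<^sub>F \<eta> in at_right (0::real). 0 < \<phi> (v + \<eta>) - \<phi> (u - \<eta>) \<and> \<eta> < (d - (v - u)) / 2 \<and> \<eta> > 0"
    by eventually_elim auto
  then obtain \<eta> where "0 < \<phi> (v + \<eta>) - \<phi> (u - \<eta>)" "\<eta> < (d - (v - u)) / 2" "\<eta> > 0"
    using eventually_happens' trivial_limit_at_right_real by blast
  then have "u - \<eta> < t" "t < v + \<eta>" "(v + \<eta>) - (u - \<eta>) < d" "\<phi> (u - \<eta>) < \<phi> (v + \<eta>)"
    using assms(2,3) by (simp_all add: field_simps)
  then show thesis by (rule that)
qed

text \<open>
  Applied to \<open>\<lambda>x. F x - s * x\<close> this says that \<open>F\<close> has slope above \<open>s\<close> on arbitrarily short intervals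
  around \<open>t\<close>, applied to \<open>\<lambda>x. r * x - F x\<close> that it has slope below \<open>r\<close> there. The point \<open>t\<close> is
  interior to the intervals, so that the set of all such \<open>t\<close> is visibly a \<open>G\<^sub>\<delta>\<close> set.
\<close>
definition steep_at :: "(real \<Rightarrow> real) \<Rightarrow> real \<Rightarrow> bool" where
  "steep_at \<phi> t \<longleftrightarrow> (\<forall>d>0. \<exists>u v. u < t \<and> t < v \<and> v - u < d \<and> \<phi> u < \<phi> v)"

text \<open>
  Difference quotients at \<open>t\<close> have \<open>t\<close> as an endpoint; for a continuous \<open>\<phi>\<close> they may be used as well.
\<close>
lemma steep_at_iff_weak:
  assumes "continuous_on UNIV \<phi>"
  shows "steep_at \<phi> t \<longleftrightarrow> (\<forall>d>0. \<exists>u v. u \<le> t \<and> t \<le> v \<and> v - u < d \<and> \<phi> u < \<phi> v)"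
proof
  assume "steep_at \<phi> t"
  then show "\<forall>d>0. \<exists>u v. u \<le> t \<and> t \<le> v \<and> v - u < d \<and> \<phi> u < \<phi> v"
    unfolding steep_at_def by (meson less_imp_le)
next
  assume weak: "\<forall>d>0. \<exists>u v. u \<le> t \<and> t \<le> v \<and> v - u < d \<and> \<phi> u < \<phi> v"
  show "steep_at \<phi> t"
    unfolding steep_at_def
  proof (intro allI impI)
    fix d :: real assume "d > 0"
    then obtain u v where "u \<le> t" "t \<le> v" "v - u < d" "\<phi> u < \<phi> v" using weak by blast
    then obtain u' v' where "u' < t" "t < v'" "v' - u' < d" "\<phi> u' < \<phi> v'"
      by (rule widen_increment[OF assms])
    then show "\<exists>u v. u < t \<and> t < v \<and> v - u < d \<and> \<phi> u < \<phi> v" by blast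
  qed
qed

lemma not_steep_atE:
  assumes "continuous_on UNIV \<phi>" and "\<not> steep_at \<phi> t"
  obtains d where "d > 0" "\<And>u v. \<lbrakk>u \<le> t; t \<le> v; v - u < d\<rbrakk> \<Longrightarrow> \<phi> v \<le> \<phi> u"
proof -
  have "\<exists>d>0. \<forall>u v. u \<le> t \<longrightarrow> t \<le> v \<longrightarrow> v - u < d \<longrightarrow> \<phi> v \<le> \<phi> u"
    using assms(2) unfolding steep_at_iff_weak[OF assms(1)] by (simp add: not_less) (meson not_less)
  then show thesis using that by metis
qed

lemma borel_steep_at: "{t. steep_at \<phi> t} \<in> sets borel"
proof -
  have "{t. steep_at \<phi> t} = (\<Inter>n::nat. \<Union>(u, v)\<in>{(u, v). v - u < 1 / Suc n \<and> \<phi> u < \<phi> v}. {u<..<v})"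
  proof (intro set_eqI iffI)
    fix t assume t: "t \<in> {t. steep_at \<phi> t}"
    show "t \<in> (\<Inter>n::nat. \<Union>(u, v)\<in>{(u, v). v - u < 1 / Suc n \<and> \<phi> u < \<phi> v}. {u<..<v})"
    proof (rule INT_I)
      fix n :: nat
      have "steep_at \<phi> t" using t by simp
      then have "\<exists>u v. u < t \<and> t < v \<and> v - u < 1 / Suc n \<and> \<phi> u < \<phi> v"
        unfolding steep_at_def by (elim allE[of _ "1 / Suc n"]) simp
      then obtain u v where "u < t" "t < v" "v - u < 1 / Suc n" "\<phi> u < \<phi> v"
        by metis
      then show "t \<in> (\<Union>(u, v)\<in>{(u, v). v - u < 1 / Suc n \<and> \<phi> u < \<phi> v}. {u<..<v})"
        by (intro UN_I[of "(u, v)"]) auto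
    qed
  next
    fix t assume t: "t \<in> (\<Inter>n::nat. \<Union>(u, v)\<in>{(u, v). v - u < 1 / Suc n \<and> \<phi> u < \<phi> v}. {u<..<v})"
    have "\<exists>u v. u < t \<and> t < v \<and> v - u < d \<and> \<phi> u < \<phi> v" if "d > 0" for d
    proof -
      obtain n where n: "1 / Suc n < d" using nat_approx_posE[OF \<open>d > 0\<close>] by metis
      have "t \<in> (\<Union>(u, v)\<in>{(u, v). v - u < 1 / Suc n \<and> \<phi> u < \<phi> v}. {u<..<v})"
        using t by (rule INT_D) simp
      then obtain u v where "u < t" "t < v" "v - u < 1 / Suc n" "\<phi> u < \<phi> v"
        by (elim UN_E) auto
      then show ?thesis using n by (intro exI[of _ u] exI[of _ v]) simp
    qed
    then show "t \<in> {t. steep_at \<phi> t}" by (simp add: steep_at_def)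
  qed
  also have "\<dots> \<in> sets borel"
    by (rule sets.countable_INT'') (auto intro!: borel_open open_UN)
  finally show ?thesis .
qed

text \<open>
  Let \<open>\<mu>\<close> be the measure that gives \<open>{u..v}\<close> the mass \<open>F v - F u\<close>, realised as the image of Lebesgue
  measure under the inverse of \<open>F\<close>. On a Borel set \<open>E\<close> of points of both kinds, the intervals of
  slope above \<open>s\<close> give \<open>s * \<lambda> E \<le> \<mu> E\<close> and those of slope below \<open>r\<close> give \<open>\<mu> E \<le> r * \<lambda> E\<close>, where \<open>\<lambda>\<close>
  is Lebesgue measure. As \<open>r < s\<close>, a bounded such \<open>E\<close> is null. The two-sided bound on the slopes
  of \<open>F\<close> makes \<open>F\<close> a bi-Lipschitz bijection of the line; the upper bound makes null sets null for \<open>\<mu>\<close>.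
\<close>
lemma negligible_steep_above_and_below:
  fixes F :: "real \<Rightarrow> real"
  assumes "c > 0" and lower: "\<And>x y. x \<le> y \<Longrightarrow> c * (y - x) \<le> F y - F x"
    and upper: "\<And>x y. x \<le> y \<Longrightarrow> F y - F x \<le> L * (y - x)"
    and "0 < r" "r < s"
  shows "negligible {t. steep_at (\<lambda>x. F x - s * x) t \<and> steep_at (\<lambda>x. r * x - F x) t}" (is "negligible ?Q")
proof -
  have "L > 0" using lower[of 0 1] upper[of 0 1] \<open>c > 0\<close> by simp
  have sm: "strict_mono F"
  proof (rule strict_monoI)
    fix x y :: real assume "x < y"
    then have "0 < c * (y - x)" using \<open>c > 0\<close> by simp
    then show "F x < F y" using lower[of x y] \<open>x < y\<close> by simp
  qed
  have lip: "\<bar>F y - F x\<bar> \<le> L * \<bar>y - x\<bar>" for x y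
    using upper[of x y] upper[of y x] strict_mono_less_eq[OF sm, of x y] strict_mono_less_eq[OF sm, of y x]
    by (cases "x \<le> y") auto
  have cont: "continuous_on UNIV F"
  proof (rule lipschitz_on_continuous_on)
    show "L-lipschitz_on UNIV F"
      using lip \<open>L > 0\<close> by (intro lipschitz_onI) (auto simp: dist_real_def abs_minus_commute)
  qed
  have surj: "\<exists>x. F x = y" for y
  proof -
    define b where "b = \<bar>y - F 0\<bar> / c"
    have b: "b \<ge> 0" "c * b = \<bar>y - F 0\<bar>" using \<open>c > 0\<close> by (auto simp: b_def)
    have "F (- b) \<le> y" "y \<le> F b"
      using lower[of 0 b] lower[of "- b" 0] b by auto
    then show ?thesis
      using IVT'[of F "- b" y b] b continuous_on_subset[OF cont] by auto
  qed
  define G where "G = inv F"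
  have FG: "F (G y) = y" for y unfolding G_def using surj by (metis f_inv_into_f rangeI)
  have GF: "G (F x) = x" for x unfolding G_def using sm by (simp add: strict_mono_imp_inj_on)
  have "mono G"
    using sm FG by (metis mono_def strict_mono_less_eq)
  then have Gm[measurable]: "G \<in> borel_measurable borel" by (rule borel_measurable_mono)
  have vimage: "G -` A = F ` A" for A
  proof
    show "G -` A \<subseteq> F ` A" using FG by (metis image_eqI subsetI vimageE)
    show "F ` A \<subseteq> G -` A" using GF by auto
  qed
  define \<mu> where "\<mu> = distr lborel borel G"
  have \<mu>: "emeasure \<mu> A = emeasure lborel (G -` A)" if "A \<in> sets borel" for A
    using that by (simp add: \<mu>_def emeasure_distr)
  have \<mu>_Icc: "emeasure \<mu> {u..v} = ennreal (F v - F u)" if "u < v" for u v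
  proof -
    have "G -` {u..v} = {F u..F v}"
    proof -
      have "u \<le> G y \<longleftrightarrow> F u \<le> y" "G y \<le> v \<longleftrightarrow> y \<le> F v" for y
        using strict_mono_less_eq[OF sm, of _ "G y"] strict_mono_less_eq[OF sm, of "G y"] by (simp_all add: FG)
      then show ?thesis by auto
    qed
    then show ?thesis
      using \<mu>[of "{u..v}"] sm that by (simp add: strict_mono_less_eq)
  qed
  have null: "emeasure \<mu> N = 0" if N: "N \<in> null_sets lborel" for N
  proof -
    have Nb: "N \<in> sets borel" using N by auto
    have "negligible N" using N by (simp add: negligible_iff_null_sets null_sets_completionI)
    then have "negligible (F ` N)"
    proof (rule negligible_locally_Lipschitz_image[rotated])
      show "\<exists>T B. open T \<and> x \<in> T \<and> (\<forall>y\<in>N \<inter> T. norm (F y - F x) \<le> B * norm (y - x))" for x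
        using lip by (intro exI[of _ UNIV] exI[of _ L]) auto
    qed simp
    moreover have "G -` N \<in> sets borel" using measurable_sets[OF Gm Nb] by simp
    ultimately have "emeasure lborel (G -` N) = 0"
      unfolding negligible_iff_null_sets vimage[symmetric] by (simp add: null_sets_completion_iff null_setsD1)
    then show ?thesis by (simp add: \<mu> Nb)
  qed
  have Qb: "?Q \<in> sets borel"
    using sets.Int[OF borel_steep_at borel_steep_at] by (simp add: Collect_conj_eq)
  have bounded_part: "emeasure lborel E = 0" if E: "E \<subseteq> ?Q" "E \<in> sets borel" "E \<subseteq> cbox a b" for E a b
  proof -
    have steep1: "steep_at (\<lambda>x. F x - s * x) t" and steep2: "steep_at (\<lambda>x. r * x - F x) t" if "t \<in> E" for t
      using that E(1) by auto
    have "emeasure (scale_measure s lborel) E \<le> emeasure \<mu> E"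
    proof (rule emeasure_le_if_Vitali_cover_le)
      show "sets (scale_measure (ennreal s) lborel) = sets borel" "sets \<mu> = sets borel"
        by (simp_all add: \<mu>_def)
      show "E \<in> sets borel" by fact
      show "emeasure (scale_measure (ennreal s) lborel) N = 0" if "N \<in> null_sets lborel" for N
        using that by (simp add: null_setsD1)
      show "\<exists>W. open W \<and> E \<subseteq> W \<and> emeasure \<mu> W \<le> emeasure \<mu> E + ennreal e" if e: "0 < e" for e :: real
      proof -
        have GE: "G -` E \<in> sets borel" using measurable_sets[OF Gm E(2)] by simp
        obtain W where W: "open W" "G -` E \<subseteq> W" "emeasure lborel (W - G -` E) \<le> ennreal e"
          by (rule outer_regular_lborel_le[OF GE e])
        have "open (F -` W)"
          using W(1) cont by (rule open_vimage)
        moreover have "E \<subseteq> F -` W" using W(2) unfolding vimage by auto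
        moreover have "emeasure \<mu> (F -` W) \<le> emeasure \<mu> E + ennreal e"
        proof -
          have "G -` (F -` W) = W" using FG by auto
          then have "emeasure \<mu> (F -` W) = emeasure lborel W"
            using \<mu>[of "F -` W"] \<open>open (F -` W)\<close> by simp
          also have "\<dots> = emeasure lborel (G -` E \<union> (W - G -` E))"
            using W(2) by (simp add: Un_absorb1)
          also have "\<dots> \<le> emeasure lborel (G -` E) + emeasure lborel (W - G -` E)"
            by (rule emeasure_subadditive) (use GE W(1) in auto)
          also have "\<dots> \<le> emeasure \<mu> E + ennreal e"
            using W(3) \<mu>[OF E(2)] by (simp add: add_left_mono)
          finally show ?thesis .
        qed
        ultimately show ?thesis by blast
      qed
      fix t d :: real assume "t \<in> E" "0 < d"
      then obtain u v where uv: "u < t" "t < v" "v - u < d" "F u - s * u < F v - s * v"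
        using steep1 unfolding steep_at_def by metis
      have "emeasure (scale_measure s lborel) {u..v} \<le> emeasure \<mu> {u..v}"
        using uv \<mu>_Icc[of u v] \<open>0 < r\<close> \<open>r < s\<close>
        by (auto simp: algebra_simps simp flip: ennreal_mult intro!: ennreal_leI)
      then show "\<exists>u v. u < t \<and> t < v \<and> v - u < d \<and>
          emeasure (scale_measure (ennreal s) lborel) {u..v} \<le> emeasure \<mu> {u..v}"
        using uv by (intro exI[of _ u] exI[of _ v]) simp
    qed
    also have "emeasure \<mu> E \<le> emeasure (scale_measure r lborel) E"
    proof (rule emeasure_le_if_Vitali_cover_le)
      show "sets (scale_measure (ennreal r) lborel) = sets borel" "sets \<mu> = sets borel"
        by (simp_all add: \<mu>_def)
      show "E \<in> sets borel" by fact
      show "emeasure \<mu> N = 0" if "N \<in> null_sets lborel" for N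
        using that by (rule null)
      show "\<exists>W. open W \<and> E \<subseteq> W \<and> emeasure (scale_measure r lborel) W \<le> emeasure (scale_measure r lborel) E + ennreal e"
        if "0 < e" for e :: real
      proof -
        have "e / r > 0" using that \<open>0 < r\<close> by simp
        obtain W where W: "open W" "E \<subseteq> W" "emeasure lborel (W - E) \<le> ennreal (e / r)"
          by (rule outer_regular_lborel_le[OF E(2) \<open>e / r > 0\<close>])
        have "emeasure lborel W = emeasure lborel (E \<union> (W - E))"
          using W(2) by (simp add: Un_absorb1)
        also have "\<dots> \<le> emeasure lborel E + emeasure lborel (W - E)"
          by (rule emeasure_subadditive) (use E W(1) in auto)
        also have "\<dots> \<le> emeasure lborel E + ennreal (e / r)"
          using W(3) by (simp add: add_left_mono)
        finally have "r * emeasure lborel W \<le> r * (emeasure lborel E + ennreal (e / r))"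
          by (rule mult_left_mono) simp
        also have "\<dots> = r * emeasure lborel E + ennreal e"
          using \<open>0 < r\<close> \<open>0 < e\<close> by (simp add: distrib_left flip: ennreal_mult)
        finally show ?thesis using W by auto
      qed
      fix t d :: real assume "t \<in> E" "0 < d"
      then obtain u v where uv: "u < t" "t < v" "v - u < d" "r * u - F u < r * v - F v"
        using steep2 unfolding steep_at_def by metis
      have "emeasure \<mu> {u..v} \<le> emeasure (scale_measure r lborel) {u..v}"
        using uv \<mu>_Icc[of u v] \<open>0 < r\<close> \<open>r < s\<close>
        by (auto simp: algebra_simps simp flip: ennreal_mult intro!: ennreal_leI)
      then show "\<exists>u v. u < t \<and> t < v \<and> v - u < d \<and>
          emeasure \<mu> {u..v} \<le> emeasure (scale_measure (ennreal r) lborel) {u..v}"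
        using uv by (intro exI[of _ u] exI[of _ v]) simp
    qed
    finally have le: "ennreal s * emeasure lborel E \<le> ennreal r * emeasure lborel E"
      by simp
    have "emeasure lborel E \<le> emeasure lborel (cbox a b)"
      using E(3) by (intro emeasure_mono) auto
    also have "\<dots> < \<infinity>" by (rule emeasure_lborel_cbox_finite)
    finally obtain m where m: "emeasure lborel E = ennreal m" "0 \<le> m"
      by (cases "emeasure lborel E") auto
    have "s * m \<le> r * m"
      using le m \<open>0 < r\<close> \<open>r < s\<close> by (simp flip: ennreal_mult)
    then have "m = 0" using m(2) \<open>r < s\<close> by (simp add: mult_le_cancel_right)
    then show ?thesis using m by simp
  qed
  show ?thesis
    unfolding negligible_on_intervals[of ?Q]
  proof (intro allI)
    fix a b :: real
    have Qab: "?Q \<inter> cbox a b \<in> sets borel" by (rule sets.Int[OF Qb]) simp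
    then have "emeasure lborel (?Q \<inter> cbox a b) = 0"
      by (rule bounded_part[OF Int_lower1 _ Int_lower2])
    with Qab have "?Q \<inter> cbox a b \<in> null_sets lborel" by (simp only: null_sets_def sets_lborel) blast
    then show "negligible (?Q \<inter> cbox a b)"
      unfolding negligible_iff_null_sets by (rule null_sets_completionI)
  qed
qed

text \<open>
  The derivative is the supremum \<open>D\<close> of the slopes \<open>s\<close> that are exceeded on arbitrarily short
  intervals around \<open>t\<close>. Above \<open>D\<close> no slope is exceeded near \<open>t\<close>, which bounds the difference
  quotients from above; below \<open>D\<close> the hypothesis rules out smaller slopes, which bounds them from
  below. Only rational slopes are tested, so that countably many null sets suffice.
\<close>
lemma differentiable_if_not_steep:
  fixes F :: "real \<Rightarrow> real"
  assumes cont: "continuous_on UNIV F" and "c > 0"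
    and lower: "\<And>x y. x \<le> y \<Longrightarrow> c * (y - x) \<le> F y - F x"
    and upper: "\<And>x y. x \<le> y \<Longrightarrow> F y - F x \<le> L * (y - x)"
    and not_steep: "\<And>r s. \<lbrakk>r \<in> \<rat>; s \<in> \<rat>; 0 < r; r < s; steep_at (\<lambda>x. F x - s * x) t\<rbrakk>
        \<Longrightarrow> \<not> steep_at (\<lambda>x. r * x - F x) t"
  shows "F differentiable (at t)"
proof -
  define P where "P s \<longleftrightarrow> steep_at (\<lambda>x. F x - s * x) t" for s
  define q where "q y = (F y - F t) / (y - t)" for y
  have above: "\<forall>\<^sub>F y in at t. q y \<le> s" if nP: "\<not> P s" for s
  proof -
    have "continuous_on UNIV (\<lambda>x. F x - s * x)" by (intro continuous_intros cont)
    then obtain d where "d > 0" and d: "\<And>u v. \<lbrakk>u \<le> t; t \<le> v; v - u < d\<rbrakk> \<Longrightarrow> F v - s * v \<le> F u - s * u"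
      using nP unfolding P_def by (rule not_steep_atE) (rule that, assumption, blast)
    have "q y \<le> s" if "y \<noteq> t" "dist y t < d" for y
      using that d[of t y] d[of y t] by (cases "t < y") (auto simp: q_def dist_real_def field_simps)
    then show ?thesis using \<open>d > 0\<close> by (auto simp: eventually_at)
  qed
  have below: "\<forall>\<^sub>F y in at t. r \<le> q y" if nP: "\<not> steep_at (\<lambda>x. r * x - F x) t" for r
  proof -
    have "continuous_on UNIV (\<lambda>x. r * x - F x)" by (intro continuous_intros cont)
    then obtain d where "d > 0" and d: "\<And>u v. \<lbrakk>u \<le> t; t \<le> v; v - u < d\<rbrakk> \<Longrightarrow> r * v - F v \<le> r * u - F u"
      using nP by (rule not_steep_atE) (rule that, assumption, blast)
    have "r \<le> q y" if "y \<noteq> t" "dist y t < d" for y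
      using that d[of t y] d[of y t] by (cases "t < y") (auto simp: q_def dist_real_def field_simps)
    then show ?thesis using \<open>d > 0\<close> by (auto simp: eventually_at)
  qed
  have anti: "P s'" if "P s" "s' < s" for s s'
    unfolding P_def steep_at_def
  proof (intro allI impI)
    fix d :: real assume "d > 0"
    then obtain u v where uv: "u < t" "t < v" "v - u < d" "F u - s * u < F v - s * v"
      using \<open>P s\<close> unfolding P_def steep_at_def by metis
    have "s' * (v - u) \<le> s * (v - u)" using \<open>s' < s\<close> uv by (intro mult_right_mono) auto
    then have "F u - s' * u < F v - s' * v" using uv(4) by (simp add: algebra_simps)
    then show "\<exists>u v. u < t \<and> t < v \<and> v - u < d \<and> F u - s' * u < F v - s' * v"
      using uv by (intro exI[of _ u] exI[of _ v]) simp
  qed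
  have small: "P (c / 2)"
    unfolding P_def steep_at_def
  proof (intro allI impI)
    fix d :: real assume "d > 0"
    have "c * (2 * d / 3) \<le> F (t + d/3) - F (t - d/3)"
      using lower[of "t - d/3" "t + d/3"] \<open>d > 0\<close> by simp
    moreover have "c / 2 * (t + d/3) - c / 2 * (t - d/3) = c * (d / 3)"
      by (simp add: algebra_simps)
    moreover have "c * (d / 3) < c * (2 * d / 3)"
      using \<open>d > 0\<close> \<open>c > 0\<close> by (intro mult_strict_left_mono) auto
    ultimately have "F (t - d/3) - c / 2 * (t - d/3) < F (t + d/3) - c / 2 * (t + d/3)"
      by linarith
    then show "\<exists>u v. u < t \<and> t < v \<and> v - u < d \<and> F u - c / 2 * u < F v - c / 2 * v"
      using \<open>d > 0\<close> by (intro exI[of _ "t - d/3"] exI[of _ "t + d/3"]) simp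
  qed
  have bound: "s \<le> L" if "P s" for s
  proof (rule ccontr)
    assume "\<not> s \<le> L"
    obtain u v where uv: "u < t" "t < v" "F u - s * u < F v - s * v"
      using \<open>P s\<close> unfolding P_def steep_at_def by (meson zero_less_one)
    have "L * (v - u) \<le> s * (v - u)" using \<open>\<not> s \<le> L\<close> uv by (intro mult_right_mono) auto
    then show False using uv upper[of u v] by (simp add: algebra_simps)
  qed
  have bdd: "bdd_above {s. P s}" using bound by (intro bdd_aboveI[of _ L]) auto
  have ne: "{s. P s} \<noteq> {}" using small by blast
  define D where "D = Sup {s. P s}"
  have "c / 2 \<le> D" unfolding D_def using small bdd by (intro cSup_upper) auto
  have "(q \<longlongrightarrow> D) (at t)"
  proof (rule order_tendstoI)
    fix a assume "a < D"
    then have "max a 0 < Sup {s. P s}" using \<open>c / 2 \<le> D\<close> \<open>c > 0\<close> by (simp add: D_def)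
    then obtain s where s: "P s" "max a 0 < s" using less_cSup_iff[OF ne bdd] by auto
    obtain s' where s': "s' \<in> \<rat>" "max a 0 < s'" "s' < s" using Rats_dense_in_real[OF s(2)] by blast
    obtain r where r: "r \<in> \<rat>" "max a 0 < r" "r < s'" using Rats_dense_in_real[OF s'(2)] by blast
    have "P s'" using anti s s' by blast
    then have "\<not> steep_at (\<lambda>x. r * x - F x) t"
      using not_steep[of r s'] r s' by (simp add: P_def)
    from below[OF this] show "\<forall>\<^sub>F y in at t. a < q y"
      by (rule eventually_mono) (use r in auto)
  next
    fix a assume a: "D < a"
    then have "\<not> P ((a + D) / 2)"
      using cSup_upper[OF _ bdd, of "(a + D) / 2"] unfolding D_def by auto
    from above[OF this] show "\<forall>\<^sub>F y in at t. q y < a"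
      by (rule eventually_mono) (use a in auto)
  qed
  then have "(F has_field_derivative D) (at t)"
    unfolding has_field_derivative_iff q_def .
  then show ?thesis
    using field_differentiable_imp_differentiable unfolding field_differentiable_def by blast
qed

lemma lipschitz_real_differentiable_ae:
  fixes g :: "real \<Rightarrow> real"
  assumes lip: "M-lipschitz_on UNIV g"
  shows "negligible {t. \<not> g differentiable (at t)}"
proof -
  have "M \<ge> 0" using lip lipschitz_on_nonneg by blast
  \<comment> \<open>Adding \<open>(M + 1) * x\<close> raises all slopes from \<open>[- M, M]\<close> into \<open>[1, 2 * M + 1]\<close>.\<close>
  define F where "F x = g x + (M + 1) * x" for x
  have g: "\<bar>g y - g x\<bar> \<le> M * (y - x)" if "x \<le> y" for x y
    using lipschitz_onD[OF lip, of y x] that by (simp add: dist_real_def)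
  have lower: "1 * (y - x) \<le> F y - F x" if "x \<le> y" for x y
    using g[OF that] by (simp add: F_def algebra_simps)
  have upper: "F y - F x \<le> (2 * M + 1) * (y - x)" if "x \<le> y" for x y
    using g[OF that] by (simp add: F_def algebra_simps)
  have cont: "continuous_on UNIV F"
    unfolding F_def by (intro continuous_intros lipschitz_on_continuous_on[OF lip])
  define R where "R = {(r, s). r \<in> \<rat> \<and> s \<in> \<rat> \<and> 0 < r \<and> r < (s::real)}"
  define Q where "Q p = {t. steep_at (\<lambda>x. F x - snd p * x) t \<and> steep_at (\<lambda>x. fst p * x - F x) t}" for p
  have "countable R"
    by (rule countable_subset[of _ "\<rat> \<times> \<rat>"]) (auto simp: R_def countable_rat)
  moreover have "negligible (Q p)" if "p \<in> R" for p
    unfolding Q_def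
    by (rule negligible_steep_above_and_below[OF zero_less_one lower upper])
      (use that in \<open>auto simp: R_def\<close>)
  ultimately have neg: "negligible (\<Union>p\<in>R. Q p)" by auto
  show ?thesis
  proof (rule negligible_subset[OF neg], rule subsetI, rule ccontr)
    fix t assume t: "t \<in> {t. \<not> g differentiable at t}" "t \<notin> (\<Union>p\<in>R. Q p)"
    have "F differentiable (at t)"
    proof (rule differentiable_if_not_steep[OF cont zero_less_one lower upper])
      fix r s :: real assume "r \<in> \<rat>" "s \<in> \<rat>" "0 < r" "r < s" "steep_at (\<lambda>x. F x - s * x) t"
      moreover from this have "t \<notin> Q (r, s)" using t(2) by (auto simp: R_def)
      ultimately show "\<not> steep_at (\<lambda>x. r * x - F x) t" by (simp add: Q_def)
    qed
    then have "(\<lambda>x. F x - (M + 1) * x) differentiable (at t)"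
      by (intro derivative_intros) auto
    then show False using t(1) by (simp add: F_def)
  qed
qed

text \<open>
  Differentiability is checked coordinatewise, and each coordinate is again Lipschitz.
\<close>
theorem lipschitz_differentiable_ae:
  fixes g :: "real \<Rightarrow> 'a::euclidean_space"
  assumes lip: "M-lipschitz_on UNIV g"
  shows "negligible {t. \<not> g differentiable (at t)}"
proof -
  have "negligible (\<Union>b\<in>Basis. {t. \<not> (\<lambda>x. g x \<bullet> b) differentiable (at t)})"
  proof (intro negligible_Union finite_imageI finite_Basis, clarify)
    fix b :: 'a assume b: "b \<in> Basis"
    have "M-lipschitz_on UNIV (\<lambda>x. g x \<bullet> b)"
    proof (rule lipschitz_onI)
      fix x y
      have "\<bar>(g x - g y) \<bullet> b\<bar> \<le> norm (g x - g y)" using b by (rule Basis_le_norm)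
      also have "\<dots> \<le> M * dist x y" using lipschitz_onD[OF lip, of x y] by (simp add: dist_norm)
      finally show "dist (g x \<bullet> b) (g y \<bullet> b) \<le> M * dist x y"
        by (simp add: dist_real_def inner_diff_left)
    qed (use lip lipschitz_on_nonneg in blast)
    then show "negligible {t. \<not> (\<lambda>x. g x \<bullet> b) differentiable (at t)}"
      by (rule lipschitz_real_differentiable_ae)
  qed
  then show ?thesis
    by (rule negligible_subset) (use differentiable_componentwise_within[of g _ UNIV] in blast)
qed

section \<open>Absolute continuity, Gronwall's inequality, means and convergent subsequences\<close>

lemma lipschitz_on_imp_absolutely_continuous_on:
  fixes f :: "real \<Rightarrow> 'a::real_normed_vector"
  assumes lip: "L-lipschitz_on S f"
  shows "absolutely_continuous_on S f"
  unfolding absolutely_continuous_on_def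
proof (intro allI impI)
  fix \<epsilon> :: real assume "\<epsilon> > 0"
  have "L \<ge> 0" using lip by (rule lipschitz_on_nonneg)
  show "\<exists>\<delta>>0. \<forall>D. D division_of \<Union>D \<and> \<Union>D \<subseteq> S \<and> (\<Sum>k\<in>D. Sup k - Inf k) < \<delta> \<longrightarrow>
        (\<Sum>k\<in>D. norm (f (Sup k) - f (Inf k))) < \<epsilon>"
  proof (intro exI[of _ "\<epsilon> / (L + 1)"] conjI allI impI)
    show "0 < \<epsilon> / (L + 1)" using \<open>\<epsilon> > 0\<close> \<open>L \<ge> 0\<close> by simp
    fix D assume "D division_of \<Union>D \<and> \<Union>D \<subseteq> S \<and> (\<Sum>k\<in>D. Sup k - Inf k) < \<epsilon> / (L + 1)"
    then have D: "D division_of \<Union>D" "\<Union>D \<subseteq> S" and len: "(\<Sum>k\<in>D. Sup k - Inf k) < \<epsilon> / (L + 1)"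
      by auto
    have K: "Inf K \<le> Sup K \<and> Inf K \<in> S \<and> Sup K \<in> S" if KD: "K \<in> D" for K
    proof -
      obtain u v where "K = cbox u v" using division_ofD(4)[OF D(1) KD] by metis
      moreover have "K \<noteq> {}" using division_ofD(3)[OF D(1) KD] .
      ultimately have "K = {u..v}" "u \<le> v" by auto
      moreover have "K \<subseteq> S" using D(2) KD by blast
      ultimately show ?thesis by auto
    qed
    have "(\<Sum>k\<in>D. norm (f (Sup k) - f (Inf k))) \<le> (\<Sum>k\<in>D. L * (Sup k - Inf k))"
    proof (rule sum_mono)
      fix k assume "k \<in> D"
      then show "norm (f (Sup k) - f (Inf k)) \<le> L * (Sup k - Inf k)"
        using K[of k] lipschitz_onD[OF lip, of "Sup k" "Inf k"] by (simp add: dist_norm)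
    qed
    also have "\<dots> = L * (\<Sum>k\<in>D. Sup k - Inf k)" by (rule sum_distrib_left[symmetric])
    also have "\<dots> \<le> L * (\<epsilon> / (L + 1))"
      using len \<open>L \<ge> 0\<close> by (intro mult_left_mono) auto
    also have "\<dots> < \<epsilon>" using \<open>\<epsilon> > 0\<close> \<open>L \<ge> 0\<close> by (simp add: field_simps)
    finally show "(\<Sum>k\<in>D. norm (f (Sup k) - f (Inf k))) < \<epsilon>" .
  qed
qed

lemma absolutely_continuous_on_convex_combination:
  fixes f g :: "real \<Rightarrow> 'a::real_normed_vector"
  assumes f: "absolutely_continuous_on S f" and g: "absolutely_continuous_on S g"
    and ab: "0 \<le> a" "0 \<le> b" "a + b = 1"
  shows "absolutely_continuous_on S (\<lambda>t. a *\<^sub>R f t + b *\<^sub>R g t)"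
  unfolding absolutely_continuous_on_def
proof (intro allI impI)
  fix \<epsilon> :: real assume "\<epsilon> > 0"
  obtain \<delta>1 where \<delta>1: "\<delta>1 > 0" "\<And>D. \<lbrakk>D division_of \<Union>D; \<Union>D \<subseteq> S; (\<Sum>k\<in>D. Sup k - Inf k) < \<delta>1\<rbrakk>
          \<Longrightarrow> (\<Sum>k\<in>D. norm (f (Sup k) - f (Inf k))) < \<epsilon>"
    using f \<open>\<epsilon> > 0\<close> unfolding absolutely_continuous_on_def by meson
  obtain \<delta>2 where \<delta>2: "\<delta>2 > 0" "\<And>D. \<lbrakk>D division_of \<Union>D; \<Union>D \<subseteq> S; (\<Sum>k\<in>D. Sup k - Inf k) < \<delta>2\<rbrakk>
          \<Longrightarrow> (\<Sum>k\<in>D. norm (g (Sup k) - g (Inf k))) < \<epsilon>"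
    using g \<open>\<epsilon> > 0\<close> unfolding absolutely_continuous_on_def by meson
  show "\<exists>\<delta>>0. \<forall>D. D division_of \<Union>D \<and> \<Union>D \<subseteq> S \<and> (\<Sum>k\<in>D. Sup k - Inf k) < \<delta> \<longrightarrow>
        (\<Sum>k\<in>D. norm (a *\<^sub>R f (Sup k) + b *\<^sub>R g (Sup k) - (a *\<^sub>R f (Inf k) + b *\<^sub>R g (Inf k)))) < \<epsilon>"
  proof (intro exI[of _ "min \<delta>1 \<delta>2"] conjI allI impI)
    show "0 < min \<delta>1 \<delta>2" using \<delta>1 \<delta>2 by simp
    fix D assume "D division_of \<Union>D \<and> \<Union>D \<subseteq> S \<and> (\<Sum>k\<in>D. Sup k - Inf k) < min \<delta>1 \<delta>2"
    then have D: "D division_of \<Union>D" "\<Union>D \<subseteq> S" "(\<Sum>k\<in>D. Sup k - Inf k) < min \<delta>1 \<delta>2"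
      by auto
    have "(\<Sum>k\<in>D. norm (a *\<^sub>R f (Sup k) + b *\<^sub>R g (Sup k) - (a *\<^sub>R f (Inf k) + b *\<^sub>R g (Inf k))))
        \<le> (\<Sum>k\<in>D. a * norm (f (Sup k) - f (Inf k)) + b * norm (g (Sup k) - g (Inf k)))"
    proof (rule sum_mono)
      fix k
      have "a *\<^sub>R f (Sup k) + b *\<^sub>R g (Sup k) - (a *\<^sub>R f (Inf k) + b *\<^sub>R g (Inf k))
          = a *\<^sub>R (f (Sup k) - f (Inf k)) + b *\<^sub>R (g (Sup k) - g (Inf k))"
        by (simp add: algebra_simps)
      also have "norm \<dots> \<le> a * norm (f (Sup k) - f (Inf k)) + b * norm (g (Sup k) - g (Inf k))"
        using ab by (intro norm_triangle_le) simp
      finally show "norm (a *\<^sub>R f (Sup k) + b *\<^sub>R g (Sup k) - (a *\<^sub>R f (Inf k) + b *\<^sub>R g (Inf k)))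
        \<le> a * norm (f (Sup k) - f (Inf k)) + b * norm (g (Sup k) - g (Inf k))" .
    qed
    also have "\<dots> = a * (\<Sum>k\<in>D. norm (f (Sup k) - f (Inf k))) + b * (\<Sum>k\<in>D. norm (g (Sup k) - g (Inf k)))"
      by (simp add: sum.distrib sum_distrib_left)
    also have "\<dots> < \<epsilon>"
      using \<delta>1(2)[OF D(1,2)] \<delta>2(2)[OF D(1,2)] D(3) ab by (intro convex_bound_lt) auto
    finally show "(\<Sum>k\<in>D. norm (a *\<^sub>R f (Sup k) + b *\<^sub>R g (Sup k) - (a *\<^sub>R f (Inf k) + b *\<^sub>R g (Inf k)))) < \<epsilon>" .
  qed
qed

text \<open>
  The function \<open>(a + K * integral {0..s} \<phi>) * exp (- K * s)\<close> of \<open>s\<close> has the derivative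
  \<open>K * exp (- K * s) * (\<phi> s - (a + K * integral {0..s} \<phi>)) \<le> 0\<close>, so it does not exceed its value \<open>a\<close> at \<open>0\<close>.
\<close>
lemma gronwall:
  fixes \<phi> :: "real \<Rightarrow> real"
  assumes cont: "continuous_on {0..T} \<phi>" and "K \<ge> 0"
    and le: "\<And>t. t \<in> {0..T} \<Longrightarrow> \<phi> t \<le> a + K * integral {0..t} \<phi>"
    and t: "t \<in> {0..T}"
  shows "\<phi> t \<le> a * exp (K * t)"
proof -
  define I where "I s = integral {0..s} \<phi>" for s
  define \<psi> where "\<psi> s = (a + K * I s) * exp (- K * s)" for s
  have I: "(I has_real_derivative \<phi> s) (at s within {0..T})" if "s \<in> {0..T}" for s
    unfolding I_def has_real_derivative_iff_has_vector_derivative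
    by (rule integral_has_vector_derivative[OF cont that])
  have "\<psi> t \<le> \<psi> 0"
  proof (rule DERIV_nonpos_imp_decreasing_open[where f = \<psi>])
    show "0 \<le> t" using t by simp
    show "continuous_on {0..t} \<psi>"
      unfolding \<psi>_def
    proof (intro continuous_intros)
      have "continuous_on {0..T} I" using I by (rule DERIV_continuous_on)
      then show "continuous_on {0..t} I" by (rule continuous_on_subset) (use t in auto)
    qed
    fix s assume s: "0 < s" "s < t"
    then have "(I has_real_derivative \<phi> s) (at s)"
      using I[of s] t at_within_Icc_at[of 0 s T] by simp
    then have "(\<psi> has_real_derivative (K * \<phi> s) * exp (- K * s) + exp (- K * s) * (- K) * (a + K * I s)) (at s)"
      unfolding \<psi>_def by (auto intro!: derivative_eq_intros)
    moreover have "(K * \<phi> s) * exp (- K * s) + exp (- K * s) * (- K) * (a + K * I s)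
        = K * exp (- K * s) * (\<phi> s - (a + K * I s))"
      by (simp add: algebra_simps)
    moreover have "\<dots> \<le> 0"
      using le[of s] s t \<open>K \<ge> 0\<close> by (intro mult_nonneg_nonpos) (auto simp: I_def)
    ultimately show "\<exists>y. (\<psi> has_real_derivative y) (at s) \<and> y \<le> 0" by metis
  qed
  then have "\<psi> t * exp (K * t) \<le> a * exp (K * t)"
    by (intro mult_right_mono) (auto simp: \<psi>_def I_def)
  also have "\<psi> t * exp (K * t) = a + K * I t"
    by (simp add: \<psi>_def mult.assoc flip: exp_add)
  finally show ?thesis using le[OF t] by (simp add: I_def)
qed

text \<open>
  A hyperplane that strictly separates the mean from \<open>U\<close> would separate it from all values of \<open>u\<close>,
  and integrating that inequality contradicts the definition of the mean.
\<close>
lemma mean_value_in_closed_convex: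
  fixes u :: "real \<Rightarrow> 'a::euclidean_space"
  assumes "convex U" "closed U" "s < t" and int: "u integrable_on {s..t}"
    and U: "\<And>r. r \<in> {s..t} \<Longrightarrow> u r \<in> U"
  shows "integral {s..t} u /\<^sub>R (t - s) \<in> U"
proof (rule ccontr)
  let ?m = "integral {s..t} u /\<^sub>R (t - s)"
  assume "?m \<notin> U"
  then obtain a b where ab: "a \<bullet> ?m < b" "\<And>x. x \<in> U \<Longrightarrow> a \<bullet> x > b"
    using separating_hyperplane_closed_point[OF assms(1,2)] by metis
  have "((\<lambda>r. a \<bullet> u r) has_integral a \<bullet> integral {s..t} u) {s..t}"
    using has_integral_linear[OF integrable_integral[OF int] bounded_linear_inner_right[of a]]
    by (simp add: o_def)
  then have "b * (t - s) \<le> a \<bullet> integral {s..t} u"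
    using has_integral_le[of "\<lambda>_. b" "b * (t - s)" "{s..t}" "\<lambda>r. a \<bullet> u r"] has_integral_const_real[of b s t]
      ab(2)[OF U] \<open>s < t\<close> by (auto simp: less_imp_le mult.commute)
  then show False using ab(1) \<open>s < t\<close> by (simp add: field_simps)
qed

text \<open>
  A diagonal argument gives convergence at the nonnegative rationals; the common Lipschitz constant
  on a neighbourhood spreads it to all times.
\<close>
lemma locally_lipschitz_convergent_subsequence:
  fixes f :: "nat \<Rightarrow> real \<Rightarrow> 'a::euclidean_space"
  assumes lip: "\<And>T. T \<ge> 0 \<Longrightarrow> \<exists>L. \<forall>n. L-lipschitz_on {0..T} (f n)"
    and bound: "\<And>t. t \<ge> 0 \<Longrightarrow> \<exists>M. \<forall>n. norm (f n t) \<le> M"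
  obtains k l where "strict_mono (k :: nat \<Rightarrow> nat)" "\<And>t. t \<ge> 0 \<Longrightarrow> (\<lambda>n. f (k n) t) \<longlonglongrightarrow> l t"
proof -
  have "\<exists>M>0. \<forall>n. norm (f n t) \<le> M" if "t \<ge> 0" for t
    using bound[OF that] by (metis gt_ex less_le_trans linear order_trans less_imp_le)
  then obtain M where M: "\<And>t. t \<ge> 0 \<Longrightarrow> M t > 0" "\<And>t n. t \<ge> 0 \<Longrightarrow> norm (f n t) \<le> M t"
    by metis
  define Q :: "real set" where "Q = \<rat> \<inter> {0..}"
  \<comment> \<open>The diagonal argument wants one bound for all times, hence the scaling by \<open>M q\<close>.\<close>
  obtain k :: "nat \<Rightarrow> nat" where k: "strict_mono k"
    "\<And>q. q \<in> Q \<Longrightarrow> \<exists>l. (\<lambda>n. f (k n) q /\<^sub>R M q) \<longlonglongrightarrow> l"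
  proof (rule function_convergent_subsequence[of Q "\<lambda>n q. f n q /\<^sub>R M q" 1])
    show "countable Q" by (simp add: Q_def countable_rat countable_Int1)
    show "norm (f n q /\<^sub>R M q) \<le> 1" if "q \<in> Q" for n q
      using M[of q] that by (simp add: Q_def field_simps)
  qed (rule that)
  have conv_Q: "Cauchy (\<lambda>n. f (k n) q)" if q: "q \<in> Q" for q
  proof -
    obtain l where "(\<lambda>n. f (k n) q /\<^sub>R M q) \<longlonglongrightarrow> l" using k(2)[OF q] by blast
    then have "(\<lambda>n. M q *\<^sub>R (f (k n) q /\<^sub>R M q)) \<longlonglongrightarrow> M q *\<^sub>R l"
      by (intro tendsto_intros)
    then show ?thesis
      using M(1)[of q] q by (intro LIMSEQ_imp_Cauchy) (simp add: Q_def)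
  qed
  have "convergent (\<lambda>n. f (k n) t)" if t: "t \<ge> 0" for t
  proof -
    have "Cauchy (\<lambda>n. f (k n) t)"
    proof (rule metric_CauchyI)
      fix e :: real assume "e > 0"
      obtain L where L: "\<And>n. L-lipschitz_on {0..t + 1} (f n)" using lip[of "t + 1"] t by auto
      have "L \<ge> 0" using L lipschitz_on_nonneg by blast
      define d where "d = min 1 (e / (3 * (L + 1)))"
      have "d > 0" using \<open>e > 0\<close> \<open>L \<ge> 0\<close> by (simp add: d_def)
      then obtain q where q: "q \<in> \<rat>" "t < q" "q < t + d" using Rats_dense_in_real[of t "t + d"] by auto
      have "q \<le> t + 1" using q(3) by (simp add: d_def)
      have close: "dist (f n t) (f n q) < e / 3" for n
      proof -
        have "dist (f n t) (f n q) \<le> L * dist t q"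
          by (rule lipschitz_onD[OF L]) (use t q \<open>q \<le> t + 1\<close> in auto)
        also have "\<dots> \<le> L * d" using q \<open>L \<ge> 0\<close> by (intro mult_left_mono) (auto simp: dist_real_def)
        also have "\<dots> \<le> L * (e / (3 * (L + 1)))" using \<open>L \<ge> 0\<close> by (intro mult_left_mono) (auto simp: d_def)
        also have "\<dots> < e / 3" using \<open>L \<ge> 0\<close> \<open>e > 0\<close> by (simp add: field_simps)
        finally show ?thesis .
      qed
      have "q \<in> Q" using q t by (simp add: Q_def)
      then obtain N where N: "\<And>m n. m \<ge> N \<Longrightarrow> n \<ge> N \<Longrightarrow> dist (f (k m) q) (f (k n) q) < e / 3"
        using metric_CauchyD[OF conv_Q, of q "e / 3"] \<open>e > 0\<close> by auto
      have "dist (f (k m) t) (f (k n) t) < e" if "m \<ge> N" "n \<ge> N" for m n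
        using close[of "k m"] close[of "k n"] N[OF that]
          dist_triangle[of "f (k m) t" "f (k n) t" "f (k m) q"] dist_triangle[of "f (k m) q" "f (k n) t" "f (k n) q"]
        by (simp add: dist_commute)
      then show "\<exists>N. \<forall>m\<ge>N. \<forall>n\<ge>N. dist (f (k m) t) (f (k n) t) < e" by blast
    qed
    then show ?thesis by (rule Cauchy_convergent)
  qed
  then have "\<And>t. t \<ge> 0 \<Longrightarrow> (\<lambda>n. f (k n) t) \<longlonglongrightarrow> lim (\<lambda>n. f (k n) t)"
    by (simp add: convergent_LIMSEQ_iff)
  with k(1) show thesis by (rule that)
qed

section \<open>Solutions and the integrated equation\<close>

lemma controls_integrable:
  fixes U :: "(real^'m) set"
  assumes u: "u \<in> controls U" and "bounded U" and "0 \<le> s"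
  shows "u integrable_on {s..t}"
proof -
  obtain M where M: "\<And>w. w \<in> U \<Longrightarrow> norm w \<le> M" using \<open>bounded U\<close> by (auto simp: bounded_iff)
  have "u \<in> borel_measurable (lebesgue_on {0..})" using u by (simp add: controls_def)
  then have "u \<in> borel_measurable (lebesgue_on {s..t})"
    by (rule measurable_restrict_mono) (use \<open>0 \<le> s\<close> in auto)
  moreover have "(\<lambda>_. M) integrable_on {s..t}" by (rule integrable_const_ivl)
  ultimately show ?thesis
    by (rule measurable_bounded_by_integrable_imp_integrable)
      (use u M \<open>0 \<le> s\<close> in \<open>auto simp: controls_def\<close>)
qed

lemma is_solution_has_integral:
  fixes A :: "real^'n^'n" and B :: "real^'m^'n"
  assumes sol: "is_solution A B x0 u x" and "0 \<le> t"
  shows "((\<lambda>s. A *v x s + B *v u s) has_integral x t - x0) {0..t}"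
proof -
  define P where "P s \<longleftrightarrow> (x has_vector_derivative (A *v x s + B *v u s)) (at s within {0..})" for s
  have "AE s in lebesgue_on {0..}. P s"
    using sol by (simp add: is_solution_def P_def)
  then have "AE s in lebesgue. s \<in> {0..} \<longrightarrow> P s"
    by (subst (asm) AE_restrict_space_iff) auto
  then obtain N where N: "N \<in> null_sets lebesgue" "{s. \<not> (s \<in> {0..} \<longrightarrow> P s)} \<subseteq> N"
    by (auto simp: eventually_ae_filter)
  have "((\<lambda>s. A *v x s + B *v u s) has_integral x t - x 0) {0..t}"
  proof (rule absolutely_continuous_on_has_integral[OF \<open>0 \<le> t\<close>])
    show "absolutely_continuous_on {0..t} x" using sol \<open>0 \<le> t\<close> by (simp add: is_solution_def)
    show "negligible N" using N(1) by (simp add: negligible_iff_null_sets)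
    fix s assume s: "s \<in> {0..t} - N"
    then have "P s" using N(2) by auto
    then show "(x has_vector_derivative (A *v x s + B *v u s)) (at s within {0..t})"
      unfolding P_def by (rule has_vector_derivative_within_subset) auto
  qed
  then show ?thesis using sol by (simp add: is_solution_def)
qed

lemma is_solution_continuous_on:
  assumes sol: "is_solution A B x0 u x" and "0 \<le> T"
  shows "continuous_on {0..T} x"
proof -
  define f where "f s = A *v x s + B *v u s" for s
  have f: "(f has_integral x t - x0) {0..t}" if "0 \<le> t" for t
    unfolding f_def by (rule is_solution_has_integral[OF sol that])
  have "continuous_on {0..T} (\<lambda>t. x0 + integral {0..t} f)"
    using f[OF \<open>0 \<le> T\<close>] by (intro continuous_intros indefinite_integral_continuous_1) (rule has_integral_integrable)
  then show ?thesis
    by (rule continuous_on_eq) (use integral_unique[OF f] in auto)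
qed

lemma is_solution_increment:
  fixes A :: "real^'n^'n" and B :: "real^'m^'n"
  assumes sol: "is_solution A B x0 u x" and u: "u \<in> controls U" "bounded U" and st: "0 \<le> s" "s \<le> t"
  shows "x t - x s = A *v integral {s..t} x + B *v integral {s..t} u"
proof -
  define f where "f r = A *v x r + B *v u r" for r
  have f: "(f has_integral x t - x0) {0..t}" if "0 \<le> t" for t
    unfolding f_def by (rule is_solution_has_integral[OF sol that])
  have "x integrable_on {s..t}"
    using st continuous_on_subset[OF is_solution_continuous_on[OF sol, of t], of "{s..t}"]
    by (intro integrable_continuous_real) auto
  moreover have "u integrable_on {s..t}" by (rule controls_integrable[OF u st(1)])
  ultimately have "(f has_integral A *v integral {s..t} x + B *v integral {s..t} u) {s..t}"
    unfolding f_def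
    by (intro has_integral_add has_integral_linear[unfolded o_def, OF integrable_integral matrix_vector_mul_bounded_linear])
  then have "integral {s..t} f = A *v integral {s..t} x + B *v integral {s..t} u" by (rule integral_unique)
  moreover have "integral {0..s} f + integral {s..t} f = integral {0..t} f"
    using st f[of t] by (intro Henstock_Kurzweil_Integration.integral_combine) auto
  ultimately show ?thesis
    using f[of s] f[of t] st by (simp add: integral_unique algebra_simps)
qed

text \<open>
  The converse of \<open>is_solution_increment\<close>, with a primitive \<open>z\<close> in place of the integral of the
  control: this form is the one that is stable under limits.
\<close>
lemma integral_equation_imp_is_solution:
  fixes A :: "real^'n^'n" and B :: "real^'m^'n"
  assumes lip: "\<And>T. 0 \<le> T \<Longrightarrow> \<exists>L. L-lipschitz_on {0..T} x"
    and eq: "\<And>t. 0 \<le> t \<Longrightarrow> x t = x0 + A *v integral {0..t} x + B *v z t" and "z 0 = 0"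
    and N: "negligible N" and z: "\<And>t. \<lbrakk>0 < t; t \<notin> N\<rbrakk> \<Longrightarrow> (z has_vector_derivative u t) (at t)"
  shows "is_solution A B x0 u x"
  unfolding is_solution_def
proof (intro conjI allI impI)
  show "x 0 = x0" using eq[of 0] \<open>z 0 = 0\<close> by simp
  show "absolutely_continuous_on {0..T} x" if "0 \<le> T" for T
    using lip[OF that] lipschitz_on_imp_absolutely_continuous_on by blast
  have der: "(x has_vector_derivative (A *v x t + B *v u t)) (at t)" if t: "0 < t" "t \<notin> N" for t
  proof -
    obtain L where "L-lipschitz_on {0..t + 1} x" using lip[of "t + 1"] t by auto
    then have "continuous_on {0..t + 1} x" by (rule lipschitz_on_continuous_on)
    then have "((\<lambda>t. integral {0..t} x) has_vector_derivative x t) (at t within {0..t + 1})"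
      by (rule integral_has_vector_derivative) (use t in auto)
    then have "((\<lambda>t. integral {0..t} x) has_vector_derivative x t) (at t)"
      using at_within_Icc_at[of 0 t "t + 1"] t by simp
    then have "((\<lambda>t. x0 + A *v integral {0..t} x + B *v z t) has_vector_derivative 0 + A *v x t + B *v u t) (at t)"
      using z[OF t]
      by (intro has_vector_derivative_add has_vector_derivative_const
          bounded_linear.has_vector_derivative[OF matrix_vector_mul_bounded_linear])
    then have "((\<lambda>t. x0 + A *v integral {0..t} x + B *v z t) has_vector_derivative A *v x t + B *v u t) (at t)"
      by simp
    then show ?thesis
      by (rule has_vector_derivative_transform_within_open[where S = "{0<..}"]) (use t eq in auto)
  qed
  have "AE t in lebesgue. t \<notin> insert 0 N"
    using N by (intro AE_not_in) (simp flip: negligible_iff_null_sets)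
  then have "AE t in lebesgue. t \<in> {0..} \<longrightarrow>
      (x has_vector_derivative (A *v x t + B *v u t)) (at t within {0..})"
  proof (rule eventually_mono, intro impI)
    fix t :: real assume "t \<notin> insert 0 N" "t \<in> {0..}"
    then have "(x has_vector_derivative (A *v x t + B *v u t)) (at t)" by (intro der) auto
    then show "(x has_vector_derivative (A *v x t + B *v u t)) (at t within {0..})"
      by (rule has_vector_derivative_at_within)
  qed
  then show "AE t in lebesgue_on {0..}.
      (x has_vector_derivative (A *v x t + B *v u t)) (at t within {0..})"
    by (subst AE_restrict_space_iff) auto
qed

text \<open>
  The control is the derivative of \<open>z\<close>. It exists almost everywhere because bounded difference
  quotients make \<open>z\<close> Lipschitz, it lies in the closed set \<open>U\<close> as a limit of difference quotients,
  and the same limit, taken along the increments \<open>1 / Suc n\<close>, shows that it is measurable. Where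
  the derivative does not exist, the control takes a fixed value from \<open>U\<close>.
\<close>
lemma control_from_primitive:
  fixes U :: "(real^'m) set"
  assumes "U \<noteq> {}" "closed U" "bounded U"
    and quot: "\<And>s t. \<lbrakk>0 \<le> s; s < t\<rbrakk> \<Longrightarrow> (z t - z s) /\<^sub>R (t - s) \<in> U"
  obtains u N where "u \<in> controls U" "negligible N"
    "\<And>t. \<lbrakk>0 < t; t \<notin> N\<rbrakk> \<Longrightarrow> (z has_vector_derivative u t) (at t)"
proof -
  obtain M where M: "\<And>w. w \<in> U \<Longrightarrow> norm w \<le> M" "M \<ge> 0"
    using \<open>bounded U\<close> \<open>U \<noteq> {}\<close> by (metis bounded_iff ex_in_conv norm_ge_zero order_trans)
  obtain w0 where "w0 \<in> U" using \<open>U \<noteq> {}\<close> by blast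
  \<comment> \<open>Extending by a constant to negative times gives a Lipschitz function on the whole line.\<close>
  define Z where "Z t = z (max 0 t)" for t
  have Z_le: "norm (Z t - Z s) \<le> M * (t - s)" if "s \<le> t" for s t
  proof (cases "max 0 s < max 0 t")
    case True
    define d where "d = max 0 t - max 0 s"
    have d: "0 < d" "d \<le> t - s" using True that by (auto simp: d_def)
    have "norm ((Z t - Z s) /\<^sub>R d) \<le> M"
      using M(1)[OF quot[OF _ True]] by (simp add: Z_def d_def)
    then have "norm (Z t - Z s) / d \<le> M" using d(1) by (simp add: divide_inverse mult.commute)
    then have "norm (Z t - Z s) \<le> M * d" using d(1) by (simp add: pos_divide_le_eq)
    also have "\<dots> \<le> M * (t - s)" using d M(2) by (intro mult_left_mono) auto
    finally show ?thesis .
  next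
    case False
    then have "max 0 s = max 0 t" using that by auto
    then show ?thesis using that M(2) by (simp add: Z_def)
  qed
  have "M-lipschitz_on UNIV Z"
  proof (rule lipschitz_onI[OF _ M(2)])
    show "dist (Z s) (Z t) \<le> M * dist s t" for s t
      using Z_le[of s t] Z_le[of t s] by (cases "s \<le> t") (auto simp: dist_norm norm_minus_commute)
  qed
  then have neg: "negligible {t. \<not> Z differentiable (at t)}" by (rule lipschitz_differentiable_ae)
  have contZ: "continuous_on UNIV Z" by (rule lipschitz_on_continuous_on) fact
  \<comment> \<open>Times \<open>t \<le> 0\<close> are excluded as the constant extension has quotients \<open>0\<close> there, perhaps outside \<open>U\<close>.\<close>
  define E where "E = {t. t \<le> 0} \<union> {t. \<not> Z differentiable (at t)}"
  define u where "u t = (if t \<in> E then w0 else vector_derivative Z (at t))" for t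
  define g where "g n t = (if t \<in> E then w0 else real (Suc n) *\<^sub>R (Z (t + 1 / Suc n) - Z t))" for n :: nat and t
  have gu: "(\<lambda>n. g n t) \<longlonglongrightarrow> u t" for t
  proof (cases "t \<in> E")
    case True
    then show ?thesis by (simp add: g_def u_def)
  next
    case False
    then have "(Z has_vector_derivative u t) (at t)"
      by (simp add: u_def E_def vector_derivative_works[symmetric])
    then have "((\<lambda>h. norm (Z (t + h) - Z t - h *\<^sub>R u t) / norm h) \<longlongrightarrow> 0) (at 0)"
      by (simp add: has_vector_derivative_def has_derivative_at)
    then have "((\<lambda>h. norm ((Z (t + h) - Z t) /\<^sub>R h - u t)) \<longlongrightarrow> 0) (at 0)"
    proof (rule Lim_transform_eventually)
      have "norm (Z (t + h) - Z t - h *\<^sub>R u t) / norm h = norm ((Z (t + h) - Z t) /\<^sub>R h - u t)"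
        if "h \<noteq> 0" for h
      proof -
        have "(Z (t + h) - Z t) /\<^sub>R h - u t = (Z (t + h) - Z t - h *\<^sub>R u t) /\<^sub>R h"
          using that by (simp add: scaleR_diff_right)
        then show ?thesis by (simp add: divide_inverse mult.commute)
      qed
      then show "\<forall>\<^sub>F h in at 0. norm (Z (t + h) - Z t - h *\<^sub>R u t) / norm h = norm ((Z (t + h) - Z t) /\<^sub>R h - u t)"
        by (simp add: eventually_at_filter)
    qed
    then have "((\<lambda>h. (Z (t + h) - Z t) /\<^sub>R h) \<longlongrightarrow> u t) (at 0)"
      by (rule LIM_zero_cancel[OF tendsto_norm_zero_cancel])
    moreover have "filterlim (\<lambda>n. 1 / real (Suc n)) (at 0) sequentially"
    proof (rule filterlim_atI)
      show "(\<lambda>n. 1 / real (Suc n)) \<longlonglongrightarrow> 0"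
        using LIMSEQ_inverse_real_of_nat by (simp only: inverse_eq_divide)
    qed auto
    ultimately have "(\<lambda>n. (Z (t + 1 / real (Suc n)) - Z t) /\<^sub>R (1 / real (Suc n))) \<longlonglongrightarrow> u t"
      by (rule filterlim_compose)
    then show ?thesis using False by (simp add: g_def)
  qed
  have gU: "g n t \<in> U" for n t
  proof (cases "t \<in> E")
    case True
    then show ?thesis using \<open>w0 \<in> U\<close> by (simp add: g_def)
  next
    case False
    then have "t > 0" by (simp add: E_def)
    then show ?thesis using False quot[of t "t + 1 / Suc n"] by (simp add: g_def Z_def)
  qed
  have "u t \<in> U" for t
    by (rule Lim_in_closed_set[OF \<open>closed U\<close> _ _ gu]) (simp_all add: gU)
  moreover have "u \<in> borel_measurable lebesgue"
  proof (rule borel_measurable_LIMSEQ_metric[OF _ gu])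
    fix n
    have "E \<in> sets lebesgue"
      unfolding E_def using negligible_imp_sets[OF neg] by (intro sets.Un) (auto simp: borel_closed)
    moreover have "(\<lambda>t. real (Suc n) *\<^sub>R (Z (t + 1 / Suc n) - Z t)) \<in> borel_measurable borel"
      by (intro borel_measurable_continuous_onI continuous_intros continuous_on_compose2[OF contZ]) auto
    then have "(\<lambda>t. real (Suc n) *\<^sub>R (Z (t + 1 / Suc n) - Z t)) \<in> borel_measurable lebesgue"
      by (intro measurable_completion) simp
    ultimately show "g n \<in> borel_measurable lebesgue"
      unfolding g_def by (intro measurable_If_set) auto
  qed
  then have "u \<in> borel_measurable (lebesgue_on {0..})" by (rule measurable_restrict_space1)
  ultimately have "u \<in> controls U" by (simp add: controls_def)
  moreover have "(z has_vector_derivative u t) (at t)" if "0 < t" "t \<notin> {t. \<not> Z differentiable (at t)}" for t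
  proof -
    have "(Z has_vector_derivative u t) (at t)"
      using that by (simp add: u_def E_def vector_derivative_works[symmetric])
    then show ?thesis
      by (rule has_vector_derivative_transform_within_open[where S = "{0<..}"]) (use that in \<open>auto simp: Z_def\<close>)
  qed
  ultimately show thesis using neg that by blast
qed

section \<open>Compactness of the solution set\<close>

lemma norm_integral_control_le:
  fixes U :: "(real^'m) set"
  assumes u: "u \<in> controls U" and M: "\<And>w. w \<in> U \<Longrightarrow> norm w \<le> M" and st: "0 \<le> s" "s \<le> t"
  shows "norm (integral {s..t} u) \<le> M * (t - s)"
proof -
  have "bounded U" using M by (auto simp: bounded_iff)
  then have "(u has_integral integral {s..t} u) (cbox s t)"
    using controls_integrable[OF u _ st(1), of t] by (simp add: integrable_integral)
  moreover have uM: "norm (u r) \<le> M" if "r \<in> cbox s t" for r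
    using that st M u by (auto simp: controls_def)
  moreover have "norm (u s) \<le> M" using uM[of s] st by simp
  then have "0 \<le> M" using norm_ge_zero[of "u s"] by linarith
  ultimately show ?thesis
    using has_integral_bound[of M u "integral {s..t} u" s t] st by simp
qed

text \<open>
  Integrating the equation bounds the increments of \<open>x\<close> by the integral of \<open>norm x\<close> and the bounded
  contribution of the control. Gronwall's inequality turns this into a bound \<open>C\<close> for \<open>x\<close> on \<open>{0..T}\<close>,
  and with \<open>C\<close> the same estimate is a Lipschitz bound.
\<close>
lemma solutions_uniformly_bounded_and_lipschitz:
  fixes A :: "real^'n^'n" and B :: "real^'m^'n" and U :: "(real^'m) set"
  assumes "bounded U" and "0 \<le> T"
  shows "\<exists>L. \<forall>x0 u x. norm x0 \<le> R \<and> u \<in> controls U \<and> is_solution A B x0 u x \<longrightarrow>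
      (\<forall>t\<in>{0..T}. norm (x t) \<le> L) \<and> L-lipschitz_on {0..T} x"
proof -
  obtain M where M: "M > 0" "\<And>w. w \<in> U \<Longrightarrow> norm w \<le> M"
    using \<open>bounded U\<close> by (auto simp: bounded_pos)
  obtain a where a: "a > 0" "\<And>y. norm (A *v y) \<le> norm y * a"
    using bounded_linear.pos_bounded[OF matrix_vector_mul_bounded_linear[of A]] by blast
  obtain b where b: "b > 0" "\<And>w. norm (B *v w) \<le> norm w * b"
    using bounded_linear.pos_bounded[OF matrix_vector_mul_bounded_linear[of B]] by blast
  define C where "C = (R + b * M * T) * exp (a * T)"
  define L where "L = max C (a * C + b * M)"
  have step: "norm (x t - x s) \<le> a * integral {s..t} (\<lambda>r. norm (x r)) + b * (M * (t - s))"
    if "u \<in> controls U" "is_solution A B x0 u x" "0 \<le> s" "s \<le> t" for u x0 x s t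
  proof -
    have contx: "continuous_on {s..t} x"
      using that continuous_on_subset[OF is_solution_continuous_on[OF that(2), of t], of "{s..t}"] by auto
    have "norm (x t - x s) \<le> norm (A *v integral {s..t} x) + norm (B *v integral {s..t} u)"
      unfolding is_solution_increment[OF that(2,1) \<open>bounded U\<close> that(3,4)] by (rule norm_triangle_ineq)
    moreover have "norm (A *v integral {s..t} x) \<le> a * integral {s..t} (\<lambda>r. norm (x r))"
    proof -
      have "norm (integral {s..t} x) \<le> integral {s..t} (\<lambda>r. norm (x r))"
        by (intro integral_norm_bound_integral integrable_continuous_real continuous_intros contx) auto
      then have "norm (integral {s..t} x) * a \<le> integral {s..t} (\<lambda>r. norm (x r)) * a"
        using a(1) by (intro mult_right_mono) auto
      then show ?thesis
        using a(2)[of "integral {s..t} x"] by (simp add: mult.commute)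
    qed
    moreover have "norm (B *v integral {s..t} u) \<le> b * (M * (t - s))"
    proof -
      have "norm (integral {s..t} u) * b \<le> M * (t - s) * b"
        using b(1) norm_integral_control_le[OF that(1) M(2) that(3,4)] by (intro mult_right_mono) auto
      then show ?thesis
        using b(2)[of "integral {s..t} u"] by (simp add: mult.commute)
    qed
    ultimately show ?thesis by linarith
  qed
  have bound: "norm (x t) \<le> C"
    if x0: "norm x0 \<le> R" and u: "u \<in> controls U" and sol: "is_solution A B x0 u x" and t: "t \<in> {0..T}" for x0 u x t
  proof -
    have "x 0 = x0" using sol by (simp add: is_solution_def)
    have "norm (x t) \<le> (R + b * M * T) * exp (a * t)"
    proof (rule gronwall[OF _ _ _ t])
      show "continuous_on {0..T} (\<lambda>t. norm (x t))"
        by (intro continuous_intros is_solution_continuous_on[OF sol \<open>0 \<le> T\<close>])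
      show "0 \<le> a" using a by simp
      fix r assume r: "r \<in> {0..T}"
      have "norm (x r) \<le> norm (x 0) + norm (x r - x 0)" by (rule norm_triangle_sub)
      moreover have "b * (M * (r - 0)) \<le> b * M * T" using r b M by (simp add: mult_left_mono)
      ultimately show "norm (x r) \<le> R + b * M * T + a * integral {0..r} (\<lambda>t. norm (x t))"
        using step[OF u sol, of 0 r] r x0 \<open>x 0 = x0\<close> by simp
    qed
    also have "\<dots> \<le> C"
    proof -
      have "0 \<le> R" using x0 norm_ge_zero[of x0] by linarith
      then show ?thesis using t a b M \<open>0 \<le> T\<close> by (auto simp: C_def intro!: mult_left_mono)
    qed
    finally show ?thesis .
  qed
  have lip: "L-lipschitz_on {0..T} x"
    if x0: "norm x0 \<le> R" and u: "u \<in> controls U" and sol: "is_solution A B x0 u x" for x0 u x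
  proof -
    have "norm (x 0) \<le> C" using bound[OF x0 u sol, of 0] \<open>0 \<le> T\<close> by simp
    then have "0 \<le> C" using norm_ge_zero[of "x 0"] by linarith
    then have L0: "0 \<le> L" "a * C + b * M \<le> L" by (auto simp: L_def)
    have incr: "norm (x t - x s) \<le> L * (t - s)" if "0 \<le> s" "s \<le> t" "t \<le> T" for s t
    proof -
      have "integral {s..t} (\<lambda>r. norm (x r)) \<le> integral {s..t} (\<lambda>r. C)"
      proof (rule integral_le)
        have "continuous_on {s..t} x"
          using that by (intro continuous_on_subset[OF is_solution_continuous_on[OF sol \<open>0 \<le> T\<close>]]) auto
        then show "(\<lambda>r. norm (x r)) integrable_on {s..t}"
          by (intro integrable_continuous_real continuous_intros)
        show "norm (x r) \<le> C" if "r \<in> {s..t}" for r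
          using that \<open>0 \<le> s\<close> \<open>t \<le> T\<close> by (intro bound[OF x0 u sol]) auto
      qed auto
      then have "a * integral {s..t} (\<lambda>r. norm (x r)) \<le> a * (C * (t - s))"
        using a(1) that by (intro mult_left_mono) (auto simp: mult.commute)
      then have "norm (x t - x s) \<le> (a * C + b * M) * (t - s)"
        using step[OF u sol that(1,2)] by (simp add: algebra_simps)
      also have "\<dots> \<le> L * (t - s)" using L0 that by (intro mult_right_mono) auto
      finally show ?thesis .
    qed
    show ?thesis
    proof (rule lipschitz_onI[OF _ L0(1)])
      fix s t assume "s \<in> {0..T}" "t \<in> {0..T}"
      then show "dist (x s) (x t) \<le> L * dist s t"
        using incr[of s t] incr[of t s] by (cases "s \<le> t") (auto simp: dist_norm norm_minus_commute)
    qed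
  qed
  show ?thesis
  proof (intro exI[of _ L] allI impI, elim conjE, intro conjI ballI)
    fix x0 u x t
    assume *: "norm x0 \<le> R" "u \<in> controls U" "is_solution A B x0 u x"
    show "L-lipschitz_on {0..T} x" by (rule lip[OF *])
    assume "t \<in> {0..T}"
    then show "norm (x t) \<le> L" using bound[OF *, of t] by (simp add: L_def)
  qed
qed

text \<open>
  The subsequence is chosen for the pairs of trajectory and primitive of the control. Only the
  primitives converge; the limit control \<open>v\<close> is the derivative of the limit primitive \<open>Z\<close>, and it
  need not be a pointwise limit of the controls \<open>u n\<close>.
\<close>
theorem solutions_sequentially_compact:
  fixes A :: "real^'n^'n" and B :: "real^'m^'n" and U :: "(real^'m) set"
  assumes "U \<noteq> {}" "convex U" "compact U"
    and u: "\<And>n. u n \<in> controls U" and sol: "\<And>n. is_solution A B (x0 n) (u n) (x n)"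
    and x0: "x0 \<longlonglongrightarrow> l"
  obtains k v y where "strict_mono (k :: nat \<Rightarrow> nat)" "v \<in> controls U" "is_solution A B l v y"
    "\<And>t. 0 \<le> t \<Longrightarrow> (\<lambda>n. x (k n) t) \<longlonglongrightarrow> y t"
proof -
  have "bounded U" "closed U" using \<open>compact U\<close> by (auto simp: compact_imp_bounded compact_imp_closed)
  obtain M where M: "M > 0" "\<And>w. w \<in> U \<Longrightarrow> norm w \<le> M"
    using \<open>bounded U\<close> by (auto simp: bounded_pos)
  obtain R where R: "\<And>n. norm (x0 n) \<le> R"
    using convergent_imp_bounded[OF x0] by (auto simp: bounded_iff)
  define z where "z n t = integral {0..t} (u n)" for n t
  have z_diff: "z n t - z n s = integral {s..t} (u n)" if "0 \<le> s" "s \<le> t" for n s t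
    using Henstock_Kurzweil_Integration.integral_combine[OF that controls_integrable[OF u \<open>bounded U\<close> order_refl, of n t]]
    by (simp add: z_def algebra_simps)
  have lip_z: "M-lipschitz_on {0..T} (z n)" for n T
  proof (rule lipschitz_onI)
    have z_le: "norm (z n t - z n s) \<le> M * (t - s)" if "0 \<le> s" "s \<le> t" for s t
      unfolding z_diff[OF that] by (rule norm_integral_control_le[OF u M(2) that])
    fix s t assume "s \<in> {0..T}" "t \<in> {0..T}"
    then show "dist (z n s) (z n t) \<le> M * dist s t"
      using z_le[of s t] z_le[of t s]
      by (cases "s \<le> t") (auto simp: dist_norm norm_minus_commute)
  qed (use M in simp)
  have bds: "\<exists>L. (\<forall>n. \<forall>t\<in>{0..T}. norm (x n t) \<le> L) \<and> (\<forall>n. L-lipschitz_on {0..T} (x n))" if "0 \<le> T" for T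
  proof -
    obtain L where "\<forall>x0 u x. norm x0 \<le> R \<and> u \<in> controls U \<and> is_solution A B x0 u x \<longrightarrow>
        (\<forall>t\<in>{0..T}. norm (x t) \<le> L) \<and> L-lipschitz_on {0..T} x"
      using solutions_uniformly_bounded_and_lipschitz[OF \<open>bounded U\<close> \<open>0 \<le> T\<close>] by metis
    then have "(\<forall>t\<in>{0..T}. norm (x n t) \<le> L) \<and> L-lipschitz_on {0..T} (x n)" for n
      using R[of n] u[of n] sol[of n] by blast
    then show ?thesis by (intro exI[of _ L]) simp
  qed
  define f where "f n t = (x n t, z n t)" for n t
  obtain k p where k: "strict_mono k" and p: "\<And>t. 0 \<le> t \<Longrightarrow> (\<lambda>n. f (k n) t) \<longlonglongrightarrow> p t"
  proof (rule locally_lipschitz_convergent_subsequence)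
    fix T :: real assume "0 \<le> T"
    obtain L where L: "\<And>n t. t \<in> {0..T} \<Longrightarrow> norm (x n t) \<le> L" "\<And>n. L-lipschitz_on {0..T} (x n)"
      using bds[OF \<open>0 \<le> T\<close>] by blast
    have "(sqrt (L\<^sup>2 + M\<^sup>2))-lipschitz_on {0..T} (f n)" for n
      unfolding f_def by (rule lipschitz_on_Pair[OF L(2) lip_z])
    then show "\<exists>L. \<forall>n. L-lipschitz_on {0..T} (f n)" by blast
    have "norm (f n T) \<le> L + M * T" for n
    proof -
      have "norm (f n T) \<le> norm (x n T) + norm (z n T)" unfolding f_def by (rule norm_Pair_le)
      moreover have "norm (z n T) \<le> M * T"
        using norm_integral_control_le[OF u M(2) order_refl \<open>0 \<le> T\<close>] by (simp add: z_def)
      moreover have "norm (x n T) \<le> L" using L(1) \<open>0 \<le> T\<close> by simp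
      ultimately show ?thesis by linarith
    qed
    then show "\<exists>M. \<forall>n. norm (f n T) \<le> M" by blast
  qed (rule that)
  define y where "y t = fst (p t)" for t
  define Z where "Z t = snd (p t)" for t
  have y: "(\<lambda>n. x (k n) t) \<longlonglongrightarrow> y t" and Z: "(\<lambda>n. z (k n) t) \<longlonglongrightarrow> Z t" if "0 \<le> t" for t
    using tendsto_fst[OF p[OF that]] tendsto_snd[OF p[OF that]] by (simp_all add: f_def y_def Z_def)
  have quot: "(Z t - Z s) /\<^sub>R (t - s) \<in> U" if st: "0 \<le> s" "s < t" for s t
  proof (rule Lim_in_closed_set[OF \<open>closed U\<close>])
    show "(\<lambda>n. (z (k n) t - z (k n) s) /\<^sub>R (t - s)) \<longlonglongrightarrow> (Z t - Z s) /\<^sub>R (t - s)"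
      using st by (intro tendsto_intros Z) auto
    have "(z n t - z n s) /\<^sub>R (t - s) \<in> U" for n
      using st mean_value_in_closed_convex[OF \<open>convex U\<close> \<open>closed U\<close> \<open>s < t\<close> controls_integrable[OF u \<open>bounded U\<close> \<open>0 \<le> s\<close>]]
        z_diff[of s t] u[of n] by (simp add: controls_def)
    then show "\<forall>\<^sub>F n in sequentially. (z (k n) t - z (k n) s) /\<^sub>R (t - s) \<in> U" by simp
  qed simp
  obtain v N where v: "v \<in> controls U" "negligible N"
    "\<And>t. \<lbrakk>0 < t; t \<notin> N\<rbrakk> \<Longrightarrow> (Z has_vector_derivative v t) (at t)"
    using control_from_primitive[OF \<open>U \<noteq> {}\<close> \<open>closed U\<close> \<open>bounded U\<close> quot] by metis
  have "is_solution A B l v y"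
  proof (rule integral_equation_imp_is_solution[OF _ _ _ v(2,3)])
    show "Z 0 = 0"
      using LIMSEQ_unique[OF Z[of 0]] by (simp add: z_def)
    show "\<exists>L. L-lipschitz_on {0..T} y" if T: "0 \<le> T" for T
    proof -
      obtain L where L: "\<And>n. L-lipschitz_on {0..T} (x n)" using bds[OF T] by blast
      have "L-lipschitz_on {0..T} y"
      proof (rule lipschitz_onI)
        show "0 \<le> L" using L lipschitz_on_nonneg by blast
        fix s t assume st: "s \<in> {0..T}" "t \<in> {0..T}"
        show "dist (y s) (y t) \<le> L * dist s t"
        proof (rule LIMSEQ_le_const2)
          show "(\<lambda>n. dist (x (k n) s) (x (k n) t)) \<longlonglongrightarrow> dist (y s) (y t)"
            using st by (intro tendsto_dist y) auto
          show "\<exists>N. \<forall>n\<ge>N. dist (x (k n) s) (x (k n) t) \<le> L * dist s t"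
            using lipschitz_onD[OF L st] by blast
        qed
      qed
      then show ?thesis ..
    qed
    fix t :: real assume t: "0 \<le> t"
    obtain L where L: "\<And>n s. s \<in> {0..t} \<Longrightarrow> norm (x n s) \<le> L" using bds[OF t] by blast
    have "(\<lambda>n. integral {0..t} (x (k n))) \<longlonglongrightarrow> integral {0..t} y"
    proof (rule dominated_convergence(2))
      show "x (k n) integrable_on {0..t}" for n
        by (rule integrable_continuous_real[OF is_solution_continuous_on[OF sol t]])
      show "(\<lambda>_. L) integrable_on {0..t}" by (rule integrable_const_ivl)
      show "norm (x (k n) s) \<le> L" if "s \<in> {0..t}" for n s by (rule L[OF that])
      show "(\<lambda>n. x (k n) s) \<longlonglongrightarrow> y s" if "s \<in> {0..t}" for s using that by (intro y) simp
    qed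
    then have "(\<lambda>n. x0 (k n) + A *v integral {0..t} (x (k n)) + B *v z (k n) t)
        \<longlonglongrightarrow> l + A *v integral {0..t} y + B *v Z t"
      using LIMSEQ_subseq_LIMSEQ[OF x0 k]
      by (intro tendsto_add bounded_linear.tendsto[OF matrix_vector_mul_bounded_linear] Z[OF t]) (auto simp: o_def)
    moreover have "x0 (k n) + A *v integral {0..t} (x (k n)) + B *v z (k n) t = x (k n) t" for n
      using is_solution_increment[OF sol u \<open>bounded U\<close> order_refl t, of "k n"] sol[of "k n"]
      by (simp add: z_def is_solution_def algebra_simps)
    ultimately show "y t = l + A *v integral {0..t} y + B *v Z t"
      using LIMSEQ_unique[OF y[OF t]] by simp
  qed
  with k v(1) show thesis using y by (rule that)
qed

lemma is_solution_convex_combination: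
  fixes A :: "real^'n^'n" and B :: "real^'m^'n"
  assumes x: "is_solution A B x0 u x" and y: "is_solution A B y0 v y"
    and ab: "0 \<le> a" "0 \<le> b" "a + b = 1"
  shows "is_solution A B (a *\<^sub>R x0 + b *\<^sub>R y0) (\<lambda>t. a *\<^sub>R u t + b *\<^sub>R v t) (\<lambda>t. a *\<^sub>R x t + b *\<^sub>R y t)"
  unfolding is_solution_def
proof (intro conjI allI impI)
  show "a *\<^sub>R x 0 + b *\<^sub>R y 0 = a *\<^sub>R x0 + b *\<^sub>R y0" using x y by (simp add: is_solution_def)
  show "absolutely_continuous_on {0..T} (\<lambda>t. a *\<^sub>R x t + b *\<^sub>R y t)" if "0 \<le> T" for T
    using x y that ab by (intro absolutely_continuous_on_convex_combination) (auto simp: is_solution_def)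
  have "AE t in lebesgue_on {0..}. (x has_vector_derivative (A *v x t + B *v u t)) (at t within {0..})"
    "AE t in lebesgue_on {0..}. (y has_vector_derivative (A *v y t + B *v v t)) (at t within {0..})"
    using x y by (simp_all add: is_solution_def)
  then show "AE t in lebesgue_on {0..}. ((\<lambda>t. a *\<^sub>R x t + b *\<^sub>R y t) has_vector_derivative
      A *v (a *\<^sub>R x t + b *\<^sub>R y t) + B *v (a *\<^sub>R u t + b *\<^sub>R v t)) (at t within {0..})"
  proof eventually_elim
    case (elim t)
    then have "((\<lambda>t. a *\<^sub>R x t + b *\<^sub>R y t) has_vector_derivative
        a *\<^sub>R (A *v x t + B *v u t) + b *\<^sub>R (A *v y t + B *v v t)) (at t within {0..})"
      by (intro has_vector_derivative_add bounded_linear.has_vector_derivative[OF bounded_linear_scaleR_right])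
    moreover have "a *\<^sub>R (A *v x t + B *v u t) + b *\<^sub>R (A *v y t + B *v v t)
        = A *v (a *\<^sub>R x t + b *\<^sub>R y t) + B *v (a *\<^sub>R u t + b *\<^sub>R v t)"
      by (simp add: matrix_vector_right_distrib matrix_vector_mult_scaleR scaleR_right_distrib)
    ultimately show ?case by simp
  qed
qed

lemma controls_convex_combination:
  fixes U :: "(real^'m) set"
  assumes "convex U" "u \<in> controls U" "v \<in> controls U" "0 \<le> a" "0 \<le> b" "a + b = 1"
  shows "(\<lambda>t. a *\<^sub>R u t + b *\<^sub>R v t) \<in> controls U"
  using assms by (auto simp: controls_def intro: convexD intro!: borel_measurable_add borel_measurable_scaleR)

lemma convex_constraint_set: "convex (constraint_set H h i)"
proof -
  have "constraint_set H h i = {x. H $ i \<bullet> x \<le> - h $ i}" by (auto simp: constraint_set_def)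
  then show ?thesis by (simp add: convex_halfspace_le)
qed

lemma closed_constraint_set: "closed (constraint_set H h i)"
  unfolding constraint_set_def by (intro closed_Collect_le continuous_intros)

lemma convex_admissible_set:
  fixes A :: "real^'n^'n"
  assumes "convex U"
  shows "convex (admissible_set A B U H h i)"
proof (rule convexI)
  let ?G = "constraint_set H h i"
  fix x0 y0 :: "real^'n" and a b :: real
  assume "x0 \<in> admissible_set A B U H h i" "y0 \<in> admissible_set A B U H h i" and ab: "0 \<le> a" "0 \<le> b" "a + b = 1"
  then obtain u x v y where *: "x0 \<in> ?G" "u \<in> controls U" "is_solution A B x0 u x" "\<And>t. t \<ge> 0 \<Longrightarrow> x t \<in> ?G"
    "y0 \<in> ?G" "v \<in> controls U" "is_solution A B y0 v y" "\<And>t. t \<ge> 0 \<Longrightarrow> y t \<in> ?G"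
    unfolding admissible_set_def by blast
  have G: "a *\<^sub>R p + b *\<^sub>R q \<in> ?G" if "p \<in> ?G" "q \<in> ?G" for p q
    using that ab by (intro convexD[OF convex_constraint_set])
  show "a *\<^sub>R x0 + b *\<^sub>R y0 \<in> admissible_set A B U H h i"
    unfolding admissible_set_def
  proof (intro CollectI conjI bexI exI allI impI)
    show "a *\<^sub>R x0 + b *\<^sub>R y0 \<in> ?G" by (intro G *)
    show "is_solution A B (a *\<^sub>R x0 + b *\<^sub>R y0) (\<lambda>t. a *\<^sub>R u t + b *\<^sub>R v t) (\<lambda>t. a *\<^sub>R x t + b *\<^sub>R y t)"
      by (rule is_solution_convex_combination[OF *(3,7) ab])
    show "(\<lambda>t. a *\<^sub>R u t + b *\<^sub>R v t) \<in> controls U"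
      by (rule controls_convex_combination[OF assms *(2,6) ab])
    show "a *\<^sub>R x t + b *\<^sub>R y t \<in> ?G" if "t \<ge> 0" for t
      by (intro G * that)
  qed
qed

lemma closed_admissible_set:
  assumes "U \<noteq> {}" "convex U" "compact U"
  shows "closed (admissible_set A B U H h i)"
  unfolding closed_sequential_limits
proof (intro allI impI, elim conjE)
  let ?G = "constraint_set H h i"
  fix x0 l assume mem: "\<forall>n. x0 n \<in> admissible_set A B U H h i" and lim: "x0 \<longlonglongrightarrow> l"
  have "\<forall>n. \<exists>u x. u \<in> controls U \<and> is_solution A B (x0 n) u x \<and> (\<forall>t\<ge>0. x t \<in> ?G)"
    using mem unfolding admissible_set_def by blast
  then obtain u x where ux: "\<And>n. u n \<in> controls U" "\<And>n. is_solution A B (x0 n) (u n) (x n)"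
    "\<And>n t. t \<ge> 0 \<Longrightarrow> x n t \<in> ?G"
    by metis
  obtain k v y where "strict_mono k" and y: "v \<in> controls U" "is_solution A B l v y"
    "\<And>t. 0 \<le> t \<Longrightarrow> (\<lambda>n. x (k n) t) \<longlonglongrightarrow> y t"
    using solutions_sequentially_compact[OF assms ux(1,2) lim] by metis
  have G: "y t \<in> ?G" if "t \<ge> 0" for t
    by (rule Lim_in_closed_set[OF closed_constraint_set _ _ y(3)[OF that]]) (simp_all add: ux(3) that)
  moreover have "l \<in> ?G" using G[of 0] y(2) by (simp add: is_solution_def)
  ultimately show "l \<in> admissible_set A B U H h i"
    using y(1,2) unfolding admissible_set_def by blast
qed

theorem lemma13:
  fixes A :: "real^'n^'n" and B :: "real^'m^'n" and U :: "(real^'m) set"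
    and H :: "real^'n^'p" and h :: "real^'p" and i :: 'p
    and S :: "(real^'n) set" and N :: nat
  assumes "U \<noteq> {}" and "convex U" and "compact U"
    and "\<And>j. H $ j \<noteq> 0"
    and "interior (\<Inter>j. constraint_set H h j) \<noteq> {}"
    and "{x. \<exists>j. H $ j \<bullet> x + h $ j = 0} \<noteq> {}"
    and "finite S" and "card S = N"
    and "S \<subseteq> frontier (admissible_set A B U H h i)"
  shows "convex hull S \<subseteq> admissible_set A B U H h i"
proof (rule hull_minimal)
  show "S \<subseteq> admissible_set A B U H h i"
    using assms(9) frontier_subset_closed[OF closed_admissible_set[OF assms(1-3)]] by blast
  show "convex (admissible_set A B U H h i)" by (rule convex_admissible_set[OF assms(2)])
qed

end
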